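(* Let $A\in\mathbb{R}^{2d\times 2d}$ be an invertible matrix. The distribution $\mathcal{B}_A$ belongs to the Cohen's class if and only if there exists $M\in\mathbb{R}^{d\times d}$ such that $$A=A_M=\begin{pmatrix} I & M+\tfrac12 I \\ I & M-\tfrac12 I\end{pmatrix},$$ where $I$ is the $d\times d$ identity matrix. Furthermore, in this case, for all $f,g\in\mathcal{S}(\mathbb{R}^d)$, $$\mathcal{B}_{A_M}(f,g)=W(f,g)*\theta_M,$$ where $\theta_M\in\mathcal{S}'(\mathbb{R}^{2d})$ is given by $\theta_M=\mathcal{F}_\sigma\chi_M$ with $\chi_M(\xi,\eta)=e^{2\pi i\,\eta\cdot M\xi}$, $(\xi,\eta)\in\mathbb{R}^{d}\times\mathbb{R}^d$.
   Context: For an invertible $A=\begin{pmatrix}A_{11}&A_{12} \\ A_{21}&A_{22}\end{pmatrix}\in\mathbb{R}^{2d\times2d}$ with $d\times d$ blocks, $$\mathcal{B}_A(f,g)(x,\omega)=\int_{\mathbb{R}^d}e^{-2\pi i\omega\cdot y}f(A_{11}x+A_{12}y)\overline{g(A_{21}x+A_{22}y)}\,dy,\qquad (x,\omega)\in\mathbb{R}^{2d}.$$ The Wigner distribution is $W(f,g)(x,\omega)=\int_{\mathbb{R}^d}e^{-2\pi i y\cdot\omega}f(x+\tfrac12y)\overline{g(x-\tfrac12y)}\,dy$. A time-frequency distribution $Q$ belongs to the Cohen's class if there exists $\theta\in\mathcal{S}'(\mathbb{R}^{2d})$ such that $Q(f,g)=W(f,g)*\theta$ for all $f,g\in\mathcal{S}(\mathbb{R}^d)$.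 The Fourier transform is $\mathcal{F}F(z)=\int e^{-2\pi i z\cdot w}F(w)\,dw$. The symplectic Fourier transform of $F$ on $\mathbb{R}^{2d}$ is $\mathcal{F}_\sigma F(x,\omega)=\mathcal{F}F(\omega,-x)$, extended to $\mathcal{S}'(\mathbb{R}^{2d})$ in the usual way. *)

theory Defs
  imports "HOL-Analysis.Analysis"
begin

subsection \<open>Schwartz functions and tempered distributions\<close>

text \<open>A multi-index is given by a list \<open>bs\<close> of standard basis vectors: \<open>partials bs f\<close> takes one
  partial derivative for each entry of \<open>bs\<close>.\<close>

primrec partials ::
  "'a list \<Rightarrow> ('a::euclidean_space \<Rightarrow> complex) \<Rightarrow> 'a \<Rightarrow> complex" where
  "partials [] f = f"
| "partials (b # bs) f = (\<lambda>x. frechet_derivative (partials bs f) (at x) b)"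

definition smooth :: "('a::euclidean_space \<Rightarrow> complex) \<Rightarrow> bool" where
  "smooth f \<longleftrightarrow> (\<forall>bs \<in> lists Basis. \<forall>x. partials bs f differentiable (at x))"

definition schwartz :: "('a::euclidean_space \<Rightarrow> complex) set" where
  "schwartz = {f. smooth f \<and>
     (\<forall>k::nat. \<forall>bs \<in> lists Basis. bounded (range (\<lambda>x. norm x ^ k *\<^sub>R partials bs f x)))}"

text \<open>Uniform convergence of all weighted derivatives is convergence in every Schwartz seminorm.\<close>

definition schwartz_tendsto ::
  "(nat \<Rightarrow> 'a::euclidean_space \<Rightarrow> complex) \<Rightarrow> ('a \<Rightarrow> complex) \<Rightarrow> bool" where
  "schwartz_tendsto \<phi> \<psi> \<longleftrightarrow>
     (\<forall>k::nat. \<forall>bs \<in> lists Basis.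
        uniform_limit UNIV (\<lambda>n x. norm x ^ k *\<^sub>R partials bs (\<phi> n) x)
          (\<lambda>x. norm x ^ k *\<^sub>R partials bs \<psi> x) sequentially)"

text \<open>A distribution is a functional on all functions of which only the values on \<open>schwartz\<close>
  matter. The pairing is bilinear, and since the Schwartz space is metrizable, continuity may be
  expressed by sequences.\<close>

type_synonym 'a functional = "('a \<Rightarrow> complex) \<Rightarrow> complex"

definition tempered :: "'a::euclidean_space functional \<Rightarrow> bool" where
  "tempered T \<longleftrightarrow>
     (\<forall>\<phi>\<in>schwartz. \<forall>\<psi>\<in>schwartz. T (\<lambda>x. \<phi> x + \<psi> x) = T \<phi> + T \<psi>) \<and>
     (\<forall>c. \<forall>\<phi>\<in>schwartz. T (\<lambda>x. c * \<phi> x) = c * T \<phi>) \<and>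
     (\<forall>\<phi> \<psi>. (\<forall>n. \<phi> n \<in> schwartz) \<longrightarrow> \<psi> \<in> schwartz \<longrightarrow> schwartz_tendsto \<phi> \<psi> \<longrightarrow>
        (\<lambda>n. T (\<phi> n)) \<longlonglongrightarrow> T \<psi>)"

definition regular_dist :: "('a::euclidean_space \<Rightarrow> complex) \<Rightarrow> 'a functional" where
  "regular_dist F \<phi> = (LINT x|lborel. F x * \<phi> x)"

definition convolve ::
  "('a::euclidean_space \<Rightarrow> complex) \<Rightarrow> 'a functional \<Rightarrow> 'a \<Rightarrow> complex" where
  "convolve F T z = T (\<lambda>w. F (z - w))"

subsection \<open>Fourier transforms\<close>

definition fourier :: "('a::euclidean_space \<Rightarrow> complex) \<Rightarrow> 'a \<Rightarrow> complex" where
  "fourier F z =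
     (LINT w|lborel. exp (- 2 * complex_of_real pi * \<i> * complex_of_real (z \<bullet> w)) * F w)"

definition fourier_dist :: "'a::euclidean_space functional \<Rightarrow> 'a functional" where
  "fourier_dist T \<phi> = T (fourier \<phi>)"

text \<open>On functions the symplectic Fourier transform is \<open>F \<mapsto> fourier F \<circ> J\<close> with
  \<open>J (x, \<omega>) = (\<omega>, - x)\<close>. Composition of a distribution with \<open>J\<close> is the transpose of
  composition of test functions with \<open>J\<close>'s inverse \<open>(x, \<omega>) \<mapsto> (- \<omega>, x)\<close>, as \<open>J\<close> has
  determinant one.\<close>

definition symplectic_fourier_dist ::
  "((real^'n) \<times> (real^'n)) functional \<Rightarrow> ((real^'n) \<times> (real^'n)) functional" where
  "symplectic_fourier_dist T \<phi> = fourier_dist T (\<lambda>(x, \<omega>). \<phi> (- \<omega>, x))"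

subsection \<open>Time-frequency distributions\<close>

type_synonym 'n tf_distribution =
  "(real^'n \<Rightarrow> complex) \<Rightarrow> (real^'n \<Rightarrow> complex) \<Rightarrow> (real^'n) \<times> (real^'n) \<Rightarrow> complex"

definition wigner :: "'n::finite tf_distribution" where
  "wigner f g = (\<lambda>(x, \<omega>). LINT y|lborel.
     exp (- 2 * complex_of_real pi * \<i> * complex_of_real (y \<bullet> \<omega>)) *
       f (x + (1/2) *\<^sub>R y) * cnj (g (x - (1/2) *\<^sub>R y)))"

definition cohen_class :: "'n::finite tf_distribution \<Rightarrow> bool" where
  "cohen_class Q \<longleftrightarrow>
     (\<exists>\<theta>. tempered \<theta> \<and> (\<forall>f\<in>schwartz. \<forall>g\<in>schwartz. Q f g = convolve (wigner f g) \<theta>))"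

text \<open>A real matrix of size \<open>2d\<close> has its rows and columns indexed by \<open>'n + 'n\<close>, where
  \<open>d = CARD('n)\<close>; \<open>Inl\<close> and \<open>Inr\<close> select the first and second block.\<close>

definition block11 :: "real^('n + 'n)^('n + 'n) \<Rightarrow> real^'n^'n" where
  "block11 A = (\<chi> i j. A $ Inl i $ Inl j)"
definition block12 :: "real^('n + 'n)^('n + 'n) \<Rightarrow> real^'n^'n" where
  "block12 A = (\<chi> i j. A $ Inl i $ Inr j)"
definition block21 :: "real^('n + 'n)^('n + 'n) \<Rightarrow> real^'n^'n" where
  "block21 A = (\<chi> i j. A $ Inr i $ Inl j)"
definition block22 :: "real^('n + 'n)^('n + 'n) \<Rightarrow> real^'n^'n" where
  "block22 A = (\<chi> i j. A $ Inr i $ Inr j)"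

definition block_matrix ::
  "real^'n^'n \<Rightarrow> real^'n^'n \<Rightarrow> real^'n^'n \<Rightarrow> real^'n^'n \<Rightarrow> real^('n + 'n)^('n + 'n)" where
  "block_matrix P Q R S = (\<chi> i j. case (i, j) of
      (Inl i, Inl j) \<Rightarrow> P $ i $ j
    | (Inl i, Inr j) \<Rightarrow> Q $ i $ j
    | (Inr i, Inl j) \<Rightarrow> R $ i $ j
    | (Inr i, Inr j) \<Rightarrow> S $ i $ j)"

definition matrix_wigner :: "real^('n::finite + 'n)^('n + 'n) \<Rightarrow> 'n tf_distribution" where
  "matrix_wigner A f g = (\<lambda>(x, \<omega>). LINT y|lborel.
     exp (- 2 * complex_of_real pi * \<i> * complex_of_real (\<omega> \<bullet> y)) *
       f (block11 A *v x + block12 A *v y) * cnj (g (block21 A *v x + block22 A *v y)))"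

definition cohen_matrix :: "real^'n^'n \<Rightarrow> real^('n + 'n)^('n + 'n)" where
  "cohen_matrix M =
     block_matrix (mat 1) (M + (1/2) *\<^sub>R mat 1) (mat 1) (M - (1/2) *\<^sub>R mat 1)"

definition cohen_chirp :: "real^'n^'n \<Rightarrow> (real^'n) \<times> (real^'n) \<Rightarrow> complex" where
  "cohen_chirp M = (\<lambda>(\<xi>, \<eta>).
     exp (2 * complex_of_real pi * \<i> * complex_of_real (\<eta> \<bullet> (M *v \<xi>))))"

definition cohen_kernel :: "real^'n^'n \<Rightarrow> ((real^'n) \<times> (real^'n)) functional" where
  "cohen_kernel M = symplectic_fourier_dist (regular_dist (cohen_chirp M))"

end

theory Submission
  imports Defs "HOL-Probability.Characteristic_Functions" "HOL-Probability.Sinc_Integral"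
begin

text \<open>
  Put \<open>H (x, y) = f (x + y/2) * cnj (g (x - y/2))\<close>. The Wigner distribution is the partial Fourier
  transform of \<open>H\<close> in \<open>y\<close>, and the matrix Wigner distribution of \<open>A\<close> is the partial Fourier
  transform of \<open>f (A11 x + A12 y) * cnj (g (A21 x + A22 y))\<close>.

  \<^bold>\<open>Sufficiency.\<close> Pairing \<open>\<theta>\<^sub>M\<close> with the reflected translate of \<open>W (f, g)\<close> at \<open>(x0, \<omega>0)\<close> means
  integrating the chirp \<open>exp (2 \<pi> i \<eta> \<bullet> M \<xi>)\<close> against a full Fourier transform of \<open>W (f, g)\<close>.
  Fourier inversion in the frequency variable turns that transform into a partial Fourier transform
  of \<open>H\<close> in \<open>x\<close>, with a character coming from \<open>(x0, \<omega>0)\<close>. For fixed \<open>\<xi>\<close> the chirp is itself a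
  character in \<open>\<eta>\<close>, so a second inversion, now in \<open>\<eta>\<close>, evaluates \<open>H\<close> at \<open>(x0 + M \<xi>, \<xi>)\<close>. What
  remains is the integral that defines the matrix Wigner distribution of \<open>A\<^sub>M\<close>
  (\<open>convolve_partial_fourier_cohen_kernel\<close>, \<open>matrix_wigner_cohen_matrix\<close>). The kernel is tempered
  because the Fourier transform maps the Schwartz space continuously into \<open>L\<^sup>1\<close>
  (\<open>cohen_kernel_tempered\<close>).

  \<^bold>\<open>Necessity.\<close> A member of the Cohen class inherits the covariance of the Wigner distribution:
  translating \<open>f\<close> and \<open>g\<close> by \<open>a\<close> translates the result in \<open>x\<close> by \<open>a\<close>, and modulating both by \<open>b\<close>
  translates it in \<open>\<omega>\<close> by \<open>b\<close>. By Fourier inversion in \<open>\<omega>\<close>, the matrix Wigner distribution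
  determines the pointwise values \<open>f (A11 x + A12 y) * cnj (g (A21 x + A22 y))\<close>. For the Gaussian,
  covariance under translations forces \<open>A11 = A21 = I\<close> and covariance under modulations forces
  \<open>A12 - A22 = I\<close>, which is the asserted form with \<open>M = A12 - I/2\<close>.

  \<^bold>\<open>Analysis.\<close> All integrability rests on one majorant, the reciprocal of
  \<open>decay_weight z = \<Prod>b. 1 + (z \<bullet> b)\<^sup>2\<close>. It is integrable as a product of one-dimensional functions,
  and it factorises over product spaces, so that it also serves for partial Fourier transforms.
  Schwartz functions are bounded by a multiple of it, and so are their Fourier transforms, because
  powers of a coordinate times the transform are transforms of derivatives (\<open>fourier_diff_decay\<close>).
  Fourier inversion is proved by Gaussian summation (\<open>fourier_inversion\<close>).
\<close>

section \<open>Characters and substitution in Lebesgue integrals\<close>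

definition phase :: "real \<Rightarrow> complex" where
  "phase t = cis (2 * pi * t)"

lemma norm_phase [simp]: "norm (phase t) = 1"
  by (simp add: phase_def)

lemma phase_0 [simp]: "phase 0 = 1"
  by (simp add: phase_def)

lemma phase_add: "phase (s + t) = phase s * phase t"
  by (simp add: phase_def cis_mult distrib_left)

lemma cnj_phase: "cnj (phase t) = phase (- t)"
  by (simp add: phase_def cis_cnj)

lemma phase_exp: "phase t = exp (2 * complex_of_real pi * \<i> * complex_of_real t)"
  by (simp add: phase_def cis_conv_exp mult.commute mult.left_commute)

lemma phase_minus_exp: "phase (- t) = exp (- 2 * complex_of_real pi * \<i> * complex_of_real t)"
  by (simp add: phase_exp)

lemma continuous_on_phase [continuous_intros]:
  "continuous_on S f \<Longrightarrow> continuous_on S (\<lambda>x. phase (f x))"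
  unfolding phase_def by (intro continuous_intros)

lemma borel_measurable_phase [measurable]: "phase \<in> borel_measurable borel"
  by (intro borel_measurable_continuous_onI continuous_intros)

lemma fourier_phase: "fourier F z = (LINT w|lborel. phase (- (z \<bullet> w)) * F w)"
  unfolding fourier_def phase_minus_exp ..

lemma integrable_phase_mult:
  assumes "integrable M F" and "g \<in> borel_measurable M"
  shows "integrable M (\<lambda>x. phase (g x) * F x)"
proof (rule Bochner_Integration.integrable_bound[OF assms(1)])
  show "(\<lambda>x. phase (g x) * F x) \<in> borel_measurable M"
    using assms by measurable
qed (simp add: norm_mult)

text \<open>Lebesgue measure is the image of the product of its one-dimensional copies, so Fubini's theorem
  for finite products applies to functions that are products over the coordinates.\<close>

lemma integrable_lborel_prod:
  fixes f :: "'a::euclidean_space \<Rightarrow> real \<Rightarrow> 'c::{real_normed_field,banach,second_countable_topology}"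
  assumes "\<And>b. b \<in> Basis \<Longrightarrow> integrable lborel (f b)"
  shows "integrable lborel (\<lambda>x. \<Prod>b\<in>Basis. f b (x \<bullet> b))"
    and "(LINT x|lborel. (\<Prod>b\<in>Basis. f b (x \<bullet> b))) = (\<Prod>b\<in>Basis. (LINT t|lborel. f b t))"
proof -
  interpret product_sigma_finite "\<lambda>_::'a. lborel :: real measure" ..
  have m [measurable]: "f b \<in> borel_measurable borel" if "b \<in> Basis" for b
    using assms[OF that] by (simp add: borel_measurable_integrable)
  have eq: "(\<Prod>b\<in>Basis. f b ((\<Sum>c\<in>Basis. x c *\<^sub>R c) \<bullet> b)) = (\<Prod>b\<in>Basis. f b (x b))" for x
    by (rule prod.cong) simp_all
  have "integrable (Pi\<^sub>M Basis (\<lambda>_::'a. lborel)) (\<lambda>x. \<Prod>b\<in>Basis. f b (x b))"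
    by (rule product_integrable_prod) (use assms in auto)
  then show "integrable lborel (\<lambda>x. \<Prod>b\<in>Basis. f b (x \<bullet> b))"
    by (subst lborel_eq, subst integrable_distr_eq) (auto simp: eq)
  show "(LINT x|lborel. (\<Prod>b\<in>Basis. f b (x \<bullet> b))) = (\<Prod>b\<in>Basis. (LINT t|lborel. f b t))"
    by (subst lborel_eq, subst integral_distr) (auto simp: eq product_integral_prod assms)
qed

lemma lborel_affine_substitution:
  fixes f :: "'a::euclidean_space \<Rightarrow> 'b::{banach, second_countable_topology}"
  assumes "c \<noteq> 0" and [measurable]: "f \<in> borel_measurable borel"
  shows "integrable lborel (\<lambda>x. f (t + c *\<^sub>R x)) \<longleftrightarrow> integrable lborel f"
    and "(LINT x|lborel. f x) = \<bar>c\<bar> ^ DIM('a) *\<^sub>R (LINT x|lborel. f (t + c *\<^sub>R x))"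
proof -
  have p: "\<bar>c\<bar> ^ DIM('a) \<noteq> 0" using assms by simp
  have scale: "integrable lborel (\<lambda>x. r *\<^sub>R u x) \<longleftrightarrow> integrable lborel u"
    if "r \<noteq> 0" for r :: real and u :: "'a \<Rightarrow> 'b"
    using integrable_scaleR_right[of "1 / r" lborel "\<lambda>x. r *\<^sub>R u x"] that by auto
  show "integrable lborel (\<lambda>x. f (t + c *\<^sub>R x)) \<longleftrightarrow> integrable lborel f"
    by (subst (2) lborel_affine[OF assms(1), of t])
      (use p in \<open>simp add: integrable_density integrable_distr_eq scale\<close>)
  show "(LINT x|lborel. f x) = \<bar>c\<bar> ^ DIM('a) *\<^sub>R (LINT x|lborel. f (t + c *\<^sub>R x))"
    by (subst lborel_affine[OF assms(1), of t])
      (simp add: integral_density integral_distr p)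
qed

section \<open>An integrable majorant that factorises over product spaces\<close>

definition decay_weight :: "'a::euclidean_space \<Rightarrow> real" where
  "decay_weight z = (\<Prod>b\<in>Basis. 1 + (z \<bullet> b)\<^sup>2)"

lemma decay_weight_ge_1: "1 \<le> decay_weight z"
  unfolding decay_weight_def by (rule prod_ge_1) simp

lemma decay_weight_pos: "0 < decay_weight z"
  using decay_weight_ge_1[of z] by linarith

lemma decay_weight_Pair:
  fixes x :: "'a::euclidean_space" and y :: "'b::euclidean_space"
  shows "decay_weight (x, y) = decay_weight x * decay_weight y"
proof -
  have "inj_on (\<lambda>u::'a. (u, 0::'b)) Basis" "inj_on (\<lambda>v::'b. (0::'a, v)) Basis"
    by (auto simp: inj_on_def)
  moreover have "(\<lambda>u::'a. (u, 0::'b)) ` Basis \<inter> (\<lambda>v. (0, v)) ` Basis = {}"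
    by auto
  ultimately show ?thesis
    unfolding decay_weight_def Basis_prod_def by (simp add: prod.union_disjoint prod.reindex)
qed

lemma decay_weight_uminus [simp]: "decay_weight (- z) = decay_weight z"
  by (simp add: decay_weight_def)

lemma borel_measurable_decay_weight [measurable]: "decay_weight \<in> borel_measurable borel"
  unfolding decay_weight_def by measurable

lemma integrable_decay_weight: "integrable lborel (\<lambda>z. 1 / decay_weight z)"
proof -
  have "integrable lborel (\<lambda>t::real. inverse (1 + t\<^sup>2))"
    using integrable_inverse_1_plus_square by (simp add: set_integrable_def einterval_def)
  from integrable_lborel_prod(1)[OF this]
  have "integrable lborel (\<lambda>z::'a. \<Prod>b\<in>Basis. inverse (1 + (z \<bullet> b)\<^sup>2))" .
  then show ?thesis
    by (simp add: decay_weight_def inverse_eq_divide prod_dividef)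
qed

text \<open>Every factor \<open>1 + (z \<bullet> b)\<^sup>2\<close> is at most \<open>2 m\<^sup>2\<close> as soon as \<open>m\<close> dominates \<open>1\<close> and all
  coordinates. Taking \<open>m\<close> to be the larger of \<open>1\<close> and the norm, or of \<open>1\<close> and the largest
  coordinate, bounds the weight by pure powers. Hence the decay of a Fourier transform only needs
  iterated derivatives in a single direction, and no mixed ones.\<close>

lemma decay_weight_le_power:
  fixes z :: "'a::euclidean_space"
  assumes "1 \<le> m" and "\<And>b. b \<in> Basis \<Longrightarrow> \<bar>z \<bullet> b\<bar> \<le> m"
  shows "decay_weight z \<le> 2 ^ DIM('a) * m ^ (2 * DIM('a))"
proof -
  have "decay_weight z \<le> (\<Prod>b\<in>(Basis::'a set). 2 * m\<^sup>2)"
    unfolding decay_weight_def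
  proof (rule prod_mono, safe)
    fix b :: 'a assume "b \<in> Basis"
    then have "(z \<bullet> b)\<^sup>2 \<le> m\<^sup>2" using assms by (simp add: abs_le_square_iff[symmetric])
    moreover have "1 \<le> m\<^sup>2" using assms by simp
    ultimately show "1 + (z \<bullet> b)\<^sup>2 \<le> 2 * m\<^sup>2" by simp
  qed simp
  also have "\<dots> = 2 ^ DIM('a) * m ^ (2 * DIM('a))"
    by (simp add: power_mult_distrib power_mult)
  finally show ?thesis .
qed

lemma decay_weight_le_norm:
  fixes z :: "'a::euclidean_space"
  shows "decay_weight z \<le> 2 ^ DIM('a) * (1 + norm z ^ (2 * DIM('a)))"
proof -
  have "decay_weight z \<le> 2 ^ DIM('a) * max 1 (norm z) ^ (2 * DIM('a))"
    by (rule decay_weight_le_power) (auto simp: le_max_iff_disj Basis_le_norm)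
  also have "max 1 (norm z) ^ (2 * DIM('a)) \<le> 1 + norm z ^ (2 * DIM('a))"
    by (cases "1 \<le> norm z") (auto simp: max_def)
  finally show ?thesis by simp
qed

lemma decay_weight_le_coords:
  fixes z :: "'a::euclidean_space"
  shows "decay_weight z \<le> 2 ^ DIM('a) * (1 + (\<Sum>b\<in>Basis. \<bar>z \<bullet> b\<bar> ^ (2 * DIM('a))))"
proof -
  define m where "m = Max (insert 1 ((\<lambda>b. \<bar>z \<bullet> b\<bar>) ` (Basis::'a set)))"
  have "m \<in> insert 1 ((\<lambda>b. \<bar>z \<bullet> b\<bar>) ` (Basis::'a set))"
    unfolding m_def by (rule Max_in) auto
  then have "m ^ (2 * DIM('a)) \<le> 1 + (\<Sum>b\<in>Basis. \<bar>z \<bullet> b\<bar> ^ (2 * DIM('a)))"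
  proof
    assume "m = 1" then show ?thesis by (simp add: sum_nonneg)
  next
    assume "m \<in> (\<lambda>b. \<bar>z \<bullet> b\<bar>) ` (Basis::'a set)"
    then obtain b where b: "b \<in> Basis" "m = \<bar>z \<bullet> b\<bar>" by blast
    then have "m ^ (2 * DIM('a)) \<le> (\<Sum>b\<in>Basis. \<bar>z \<bullet> b\<bar> ^ (2 * DIM('a)))"
      by (auto intro!: member_le_sum)
    then show ?thesis by simp
  qed
  moreover have "decay_weight z \<le> 2 ^ DIM('a) * m ^ (2 * DIM('a))"
    by (rule decay_weight_le_power; unfold m_def; rule Max_ge) auto
  ultimately show ?thesis
    by (meson order_trans mult_left_mono zero_le_power zero_le_numeral)
qed

text \<open>The constants in such bounds come without a sign; this recovers it.\<close>

lemma decay_weight_bound_nonneg: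
  assumes "norm (u x) \<le> C / decay_weight x"
  shows "0 \<le> C"
proof -
  have "0 \<le> C / decay_weight x" using norm_ge_zero assms by (rule order_trans)
  then show ?thesis using decay_weight_pos[of x] by (simp add: zero_le_divide_iff)
qed

lemma integrable_decay:
  fixes u :: "'a::euclidean_space \<Rightarrow> 'b::{banach, second_countable_topology}"
  assumes "u \<in> borel_measurable borel" and bound: "\<And>x. norm (u x) \<le> C / decay_weight x"
  shows "integrable lborel u"
    and "norm (LINT x|lborel. u x) \<le> C * (LINT x|lborel. 1 / decay_weight (x::'a))"
proof -
  have w: "integrable lborel (\<lambda>x::'a. C / decay_weight x)"
    using integrable_mult_right[OF integrable_decay_weight, of C] by simp
  show i: "integrable lborel u"
  proof (rule Bochner_Integration.integrable_bound[OF w])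
    show "AE x in lborel. norm (u x) \<le> norm (C / decay_weight x)"
    proof (rule AE_I2)
      fix x
      show "norm (u x) \<le> norm (C / decay_weight x)"
        using bound[of x] abs_ge_self[of "C / decay_weight x"] unfolding real_norm_def by linarith
    qed
  qed (use assms in auto)
  have "norm (LINT x|lborel. u x) \<le> (LINT x|lborel. C / decay_weight (x::'a))"
    by (rule Bochner_Integration.integral_norm_bound_integral[OF i w bound])
  also have "\<dots> = C * (LINT x|lborel. 1 / decay_weight (x::'a))"
    by (subst integral_mult_right_zero[symmetric]) simp
  finally show "norm (LINT x|lborel. u x) \<le> C * (LINT x|lborel. 1 / decay_weight (x::'a))" .
qed

text \<open>The seminorms with the weights \<open>1\<close> and \<open>norm x ^ (2 * DIM('a))\<close> suffice for a bound by the majorant.\<close>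

lemma decay_of_norm_bounds:
  fixes u :: "'a::euclidean_space \<Rightarrow> 'b::real_normed_vector"
  assumes "norm (u x) \<le> e" and "norm x ^ (2 * DIM('a)) * norm (u x) \<le> e"
  shows "norm (u x) \<le> 2 ^ (DIM('a) + 1) * e / decay_weight x"
proof -
  have "decay_weight x * norm (u x) \<le> 2 ^ DIM('a) * (1 + norm x ^ (2 * DIM('a))) * norm (u x)"
    by (rule mult_right_mono[OF decay_weight_le_norm]) simp
  also have "\<dots> = 2 ^ DIM('a) * (norm (u x) + norm x ^ (2 * DIM('a)) * norm (u x))"
    by (simp add: algebra_simps)
  also have "\<dots> \<le> 2 ^ DIM('a) * (e + e)"
    using assms by (intro mult_left_mono add_mono) auto
  finally show ?thesis
    using decay_weight_pos[of x] by (simp add: field_simps)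
qed

section \<open>Decay and continuity of the Fourier transform on Schwartz functions\<close>

lemma schwartz_differentiable:
  "\<phi> \<in> schwartz \<Longrightarrow> bs \<in> lists Basis \<Longrightarrow> partials bs \<phi> differentiable (at x)"
  by (simp add: schwartz_def smooth_def)

lemma schwartz_continuous:
  "\<phi> \<in> schwartz \<Longrightarrow> bs \<in> lists Basis \<Longrightarrow> continuous_on S (partials bs \<phi>)"
  by (meson schwartz_differentiable continuous_at_imp_continuous_on differentiable_imp_continuous_within)

lemma schwartz_measurable:
  assumes "\<phi> \<in> schwartz" and "bs \<in> lists Basis"
  shows "partials bs \<phi> \<in> borel_measurable borel"
  using schwartz_continuous[OF assms] by (rule borel_measurable_continuous_onI)

lemma schwartz_bounds:
  assumes "\<phi> \<in> schwartz" and "bs \<in> lists Basis"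
  shows "\<exists>C. \<forall>x. norm x ^ k * norm (partials bs \<phi> x) \<le> C"
proof -
  have "bounded (range (\<lambda>x. norm x ^ k *\<^sub>R partials bs \<phi> x))"
    using assms by (simp add: schwartz_def)
  then show ?thesis by (auto simp: bounded_iff)
qed

lemma schwartz_decay:
  fixes \<phi> :: "'a::euclidean_space \<Rightarrow> complex"
  assumes "\<phi> \<in> schwartz" and "bs \<in> lists Basis"
  shows "\<exists>C. \<forall>x. norm (partials bs \<phi> x) \<le> C / decay_weight x"
proof -
  obtain C0 where C0: "\<And>x. norm x ^ 0 * norm (partials bs \<phi> x) \<le> C0"
    using schwartz_bounds[OF assms] by blast
  obtain C1 where C1: "\<And>x. norm x ^ (2 * DIM('a)) * norm (partials bs \<phi> x) \<le> C1"
    using schwartz_bounds[OF assms] by blast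
  have "norm (partials bs \<phi> x) \<le> 2 ^ (DIM('a) + 1) * max C0 C1 / decay_weight x" for x
    by (rule decay_of_norm_bounds) (use C0[of x] C1[of x] in auto)
  then show ?thesis by blast
qed

lemma schwartz_integrable:
  assumes "\<phi> \<in> schwartz" and "bs \<in> lists Basis"
  shows "integrable lborel (partials bs \<phi>)"
proof -
  obtain C where "\<And>x. norm (partials bs \<phi> x) \<le> C / decay_weight x"
    using schwartz_decay[OF assms] by blast
  then show ?thesis by (intro integrable_decay(1) schwartz_measurable assms)
qed

lemma partials_zero: "partials bs (\<lambda>_. 0) = (\<lambda>_. 0)"
  by (induction bs) (auto simp: frechet_derivative_at[OF has_derivative_const, symmetric])

lemma zero_schwartz: "(\<lambda>_. 0) \<in> schwartz"
  by (auto simp: schwartz_def smooth_def partials_zero)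

text \<open>Difference quotients along the fixed sequence of steps \<open>1 / (n + 1)\<close>, in the form in which
  dominated convergence uses them.\<close>

lemma frechet_derivative_LIMSEQ:
  fixes u :: "'a::real_normed_vector \<Rightarrow> 'b::real_normed_vector"
  assumes "u differentiable (at x)"
  shows "(\<lambda>n. real (Suc n) *\<^sub>R (u (x + (1 / real (Suc n)) *\<^sub>R v) - u x))
           \<longlonglongrightarrow> frechet_derivative u (at x) v"
proof -
  let ?D = "frechet_derivative u (at x)"
  have D: "(u has_derivative ?D) (at x)"
    using assms frechet_derivative_works by blast
  interpret bounded_linear ?D by (rule has_derivative_bounded_linear[OF D])
  have "((\<lambda>t. u (x + t *\<^sub>R v)) has_vector_derivative ?D v) (at 0)"
    unfolding has_vector_derivative_def
  proof (rule has_derivative_eq_rhs)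
    have 1: "((\<lambda>t. x + t *\<^sub>R v) has_derivative (\<lambda>t. t *\<^sub>R v)) (at 0)"
      by (auto intro!: derivative_eq_intros)
    have 2: "(u has_derivative ?D) (at (x + 0 *\<^sub>R v))" using D by simp
    show "((\<lambda>t. u (x + t *\<^sub>R v)) has_derivative (\<lambda>t. ?D (t *\<^sub>R v))) (at 0)"
      using has_derivative_compose[OF 1 2] .
  qed (simp add: scaleR)
  then have "((\<lambda>h. norm (u (x + h *\<^sub>R v) - u x - h *\<^sub>R ?D v) / norm h) \<longlongrightarrow> 0) (at 0)"
    unfolding has_vector_derivative_def has_derivative_at by simp
  moreover have "filterlim (\<lambda>n. 1 / real (Suc n)) (at 0) sequentially"
    unfolding filterlim_at using lim_inverse_n' LIMSEQ_inverse_real_of_nat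
    by (auto simp: inverse_eq_divide)
  ultimately have "(\<lambda>n. norm (u (x + (1 / real (Suc n)) *\<^sub>R v) - u x - (1 / real (Suc n)) *\<^sub>R ?D v)
      / norm (1 / real (Suc n))) \<longlonglongrightarrow> 0"
    by (rule filterlim_compose)
  also have "(\<lambda>n. norm (u (x + (1 / real (Suc n)) *\<^sub>R v) - u x - (1 / real (Suc n)) *\<^sub>R ?D v)
      / norm (1 / real (Suc n))) =
    (\<lambda>n. norm (real (Suc n) *\<^sub>R (u (x + (1 / real (Suc n)) *\<^sub>R v) - u x) - ?D v))"
  proof
    fix n
    have "real (Suc n) *\<^sub>R (u (x + (1 / real (Suc n)) *\<^sub>R v) - u x) - ?D v =
      real (Suc n) *\<^sub>R (u (x + (1 / real (Suc n)) *\<^sub>R v) - u x - (1 / real (Suc n)) *\<^sub>R ?D v)"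
      by (simp add: scaleR_diff_right)
    then show "norm (u (x + (1 / real (Suc n)) *\<^sub>R v) - u x - (1 / real (Suc n)) *\<^sub>R ?D v)
      / norm (1 / real (Suc n)) =
      norm (real (Suc n) *\<^sub>R (u (x + (1 / real (Suc n)) *\<^sub>R v) - u x) - ?D v)"
      by simp
  qed
  finally show ?thesis
    by (simp only: tendsto_norm_zero_iff LIM_zero_iff)
qed

text \<open>A step of length at most \<open>1\<close> in a coordinate direction changes one factor only, and that one by
  at most \<open>3\<close>, as \<open>r\<^sup>2 \<le> 2 (r + s)\<^sup>2 + 2 s\<^sup>2\<close>. So the difference quotients of a function whose derivative
  is bounded by the majorant are bounded by a multiple of the majorant as well.\<close>

lemma decay_weight_shift:
  fixes x b :: "'a::euclidean_space"
  assumes "b \<in> Basis" and "\<bar>s\<bar> \<le> 1"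
  shows "decay_weight x \<le> 3 * decay_weight (x + s *\<^sub>R b)"
proof -
  let ?P = "\<lambda>y::'a. \<Prod>c\<in>Basis - {b}. 1 + (y \<bullet> c)\<^sup>2"
  have split: "decay_weight y = (1 + (y \<bullet> b)\<^sup>2) * ?P y" for y :: 'a
    unfolding decay_weight_def by (rule prod.remove) (use assms in auto)
  have P: "?P (x + s *\<^sub>R b) = ?P x"
    by (rule prod.cong) (use assms in \<open>auto simp: inner_add_left inner_Basis\<close>)
  have "0 \<le> ?P x" by (rule prod_nonneg) simp
  moreover have "1 + (x \<bullet> b)\<^sup>2 \<le> 3 * (1 + ((x + s *\<^sub>R b) \<bullet> b)\<^sup>2)"
  proof -
    have shift: "(x + s *\<^sub>R b) \<bullet> b = x \<bullet> b + s"
      using assms(1) by (simp add: inner_add_left)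
    have s: "s\<^sup>2 \<le> 1" using assms(2) by (simp add: abs_square_le_1)
    have "0 \<le> (x \<bullet> b + 2 * s)\<^sup>2" by simp
    \<comment> \<open>The inequality \<open>0 \<le> (r + 2 s)\<^sup>2\<close> is \<open>r\<^sup>2 \<le> 2 (r + s)\<^sup>2 + 2 s\<^sup>2\<close> in disguise.\<close>
    define q where "q = (x \<bullet> b + s)\<^sup>2"
    have "0 \<le> q" by (simp add: q_def)
    have "(x \<bullet> b)\<^sup>2 \<le> 2 * q + 2 * s\<^sup>2"
      using \<open>0 \<le> (x \<bullet> b + 2 * s)\<^sup>2\<close> by (simp add: q_def power2_eq_square algebra_simps)
    then show ?thesis
      unfolding shift q_def[symmetric] using s \<open>0 \<le> q\<close> by (smt (verit))
  qed
  ultimately have "(1 + (x \<bullet> b)\<^sup>2) * ?P x \<le> 3 * (1 + ((x + s *\<^sub>R b) \<bullet> b)\<^sup>2) * ?P x"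
    by (rule mult_right_mono[rotated])
  then show ?thesis by (simp only: split P mult.assoc)
qed

text \<open>Instead of integrating by parts, the derivative is replaced by difference quotients. The Fourier
  transform of a difference quotient is the transform of \<open>u\<close> times a difference quotient of the
  character, and both sides converge: the left one by dominated convergence, with the majorant from the mean value
  theorem, the right one to the derivative of the character at \<open>0\<close>.\<close>

lemma fourier_frechet_derivative:
  fixes u :: "'a::euclidean_space \<Rightarrow> complex"
  assumes diff: "\<And>x. u differentiable (at x)" and int: "integrable lborel u"
    and b: "b \<in> Basis"
    and bound: "\<And>x. norm (frechet_derivative u (at x) b) \<le> C / decay_weight x"
  shows "fourier (\<lambda>x. frechet_derivative u (at x) b) z
           = 2 * complex_of_real pi * \<i> * complex_of_real (z \<bullet> b) * fourier u z"
proof -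
  define D where "D x = frechet_derivative u (at x) b" for x
  define h where "h n = 1 / real (Suc n)" for n
  define q where "q n x = real (Suc n) *\<^sub>R (u (x + h n *\<^sub>R b) - u x)" for n x
  have C: "0 \<le> C" using bound by (rule decay_weight_bound_nonneg)
  have h: "0 < h n" "h n \<le> 1" "real (Suc n) * h n = 1" for n by (auto simp: h_def)
  have [measurable]: "u \<in> borel_measurable borel"
    using int by (simp add: borel_measurable_integrable)
  have q_meas [measurable]: "q n \<in> borel_measurable borel" for n
    unfolding q_def by measurable
  have q_lim: "(\<lambda>n. q n x) \<longlonglongrightarrow> D x" for x
    unfolding q_def D_def h_def by (rule frechet_derivative_LIMSEQ[OF diff])
  have D_meas [measurable]: "D \<in> borel_measurable borel"
    by (rule borel_measurable_LIMSEQ_metric[OF q_meas q_lim])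
  have q_bound: "norm (q n x) \<le> 3 * C / decay_weight x" for n x
  proof -
    have der: "((\<lambda>t. u (x + t *\<^sub>R b)) has_derivative
        (\<lambda>s. frechet_derivative u (at (x + t *\<^sub>R b)) (s *\<^sub>R b))) (at t)" for t
    proof -
      have 1: "((\<lambda>t. x + t *\<^sub>R b) has_derivative (\<lambda>s. s *\<^sub>R b)) (at t)"
        by (auto intro!: derivative_eq_intros)
      show ?thesis
        by (rule has_derivative_compose[OF 1]) (use diff frechet_derivative_works in blast)
    qed
    have "\<exists>t\<in>{0<..<h n}. norm (u (x + h n *\<^sub>R b) - u (x + 0 *\<^sub>R b))
        \<le> norm (frechet_derivative u (at (x + t *\<^sub>R b)) ((h n - 0) *\<^sub>R b))"
      by (rule mvt_general[OF h(1)])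
        (auto intro!: der continuous_at_imp_continuous_on has_derivative_continuous[OF der])
    then obtain t where t: "0 < t" "t < h n" and
      le: "norm (u (x + h n *\<^sub>R b) - u x) \<le> norm (frechet_derivative u (at (x + t *\<^sub>R b)) (h n *\<^sub>R b))"
      by auto
    interpret L: bounded_linear "frechet_derivative u (at (x + t *\<^sub>R b))"
      using diff frechet_derivative_works has_derivative_bounded_linear by blast
    have t1: "\<bar>t\<bar> \<le> 1" using t h(2)[of n] by linarith
    have "norm (q n x) = real (Suc n) * norm (u (x + h n *\<^sub>R b) - u x)"
      by (simp add: q_def)
    also have "\<dots> \<le> real (Suc n) * (h n * norm (D (x + t *\<^sub>R b)))"
      using le h(1)[of n] by (intro mult_left_mono) (auto simp: L.scaleR D_def)
    also have "\<dots> = norm (D (x + t *\<^sub>R b))"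
      using h(3)[of n] by (metis mult.assoc mult_1)
    also have "\<dots> \<le> C / decay_weight (x + t *\<^sub>R b)"
      unfolding D_def by (rule bound)
    also have "\<dots> \<le> 3 * C / decay_weight x"
    proof -
      have "C * decay_weight x \<le> C * (3 * decay_weight (x + t *\<^sub>R b))"
        by (rule mult_left_mono[OF decay_weight_shift[OF b t1] C])
      then show ?thesis
        using decay_weight_pos[of x] decay_weight_pos[of "x + t *\<^sub>R b"] by (simp add: field_simps)
    qed
    finally show ?thesis .
  qed
  have "(\<lambda>n. LINT x|lborel. phase (- (z \<bullet> x)) * q n x) \<longlonglongrightarrow> (LINT x|lborel. phase (- (z \<bullet> x)) * D x)"
  proof (rule integral_dominated_convergence[where w = "\<lambda>x. 3 * C / decay_weight x"])
    show "integrable lborel (\<lambda>x::'a. 3 * C / decay_weight x)"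
      using integrable_mult_right[OF integrable_decay_weight, of "3 * C"] by simp
    show "AE x in lborel. (\<lambda>n. phase (- (z \<bullet> x)) * q n x) \<longlonglongrightarrow> phase (- (z \<bullet> x)) * D x"
      by (intro AE_I2 tendsto_mult q_lim tendsto_const)
    show "AE x in lborel. norm (phase (- (z \<bullet> x)) * q n x) \<le> 3 * C / decay_weight x" for n
      by (intro AE_I2) (simp add: norm_mult q_bound)
  qed measurable
  moreover have "(LINT x|lborel. phase (- (z \<bullet> x)) * q n x)
      = real (Suc n) *\<^sub>R (phase (0 + h n *\<^sub>R (z \<bullet> b)) - phase 0) * fourier u z" for n
  proof -
    let ?v = "\<lambda>x. phase (- (z \<bullet> x)) * u x"
    have v: "integrable lborel ?v" by (rule integrable_phase_mult[OF int]) simp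
    have vm: "?v \<in> borel_measurable borel" by measurable
    have vs: "integrable lborel (\<lambda>x. ?v (x + h n *\<^sub>R b))"
      and vs_eq: "(LINT x|lborel. ?v (x + h n *\<^sub>R b)) = (LINT x|lborel. ?v x)"
      using lborel_affine_substitution[of 1 ?v "h n *\<^sub>R b"] v vm by (simp_all add: add.commute)
    have "phase (- (z \<bullet> x)) * q n x =
        real (Suc n) *\<^sub>R (phase (h n * (z \<bullet> b)) * ?v (x + h n *\<^sub>R b) - ?v x)" for x
    proof -
      have "h n * (z \<bullet> b) + - (z \<bullet> (x + h n *\<^sub>R b)) = - (z \<bullet> x)"
        by (simp add: inner_add_right)
      then have "phase (h n * (z \<bullet> b)) * phase (- (z \<bullet> (x + h n *\<^sub>R b))) = phase (- (z \<bullet> x))"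
        by (metis phase_add)
      then have "phase (h n * (z \<bullet> b)) * ?v (x + h n *\<^sub>R b) = phase (- (z \<bullet> x)) * u (x + h n *\<^sub>R b)"
        by (metis mult.assoc)
      moreover have "phase (- (z \<bullet> x)) * q n x =
          real (Suc n) *\<^sub>R (phase (- (z \<bullet> x)) * u (x + h n *\<^sub>R b) - phase (- (z \<bullet> x)) * u x)"
        by (simp only: q_def mult_scaleR_right right_diff_distrib)
      ultimately show ?thesis by (simp only:)
    qed
    then have "(LINT x|lborel. phase (- (z \<bullet> x)) * q n x) =
        real (Suc n) *\<^sub>R ((phase (h n * (z \<bullet> b)) * (LINT x|lborel. ?v (x + h n *\<^sub>R b))) - (LINT x|lborel. ?v x))"
      by (simp only: integral_scaleR_right integral_mult_right_zero
          Bochner_Integration.integral_diff[OF integrable_mult_right[OF vs] v])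
    then show ?thesis
      unfolding vs_eq fourier_phase by (simp add: algebra_simps scaleR_conv_of_real)
  qed
  moreover have phase_deriv:
    "(phase has_derivative (\<lambda>t. 2 * complex_of_real pi * \<i> * complex_of_real t)) (at 0)"
  proof -
    have "phase = (\<lambda>t. exp (t *\<^sub>R (2 * complex_of_real pi * \<i>)))"
      by (auto simp: phase_exp scaleR_conv_of_real mult_ac)
    then show ?thesis
      using exp_scaleR_has_vector_derivative_right[of "2 * complex_of_real pi * \<i>" 0 UNIV]
      by (simp add: has_vector_derivative_def scaleR_conv_of_real mult_ac)
  qed
  moreover have "(\<lambda>n. real (Suc n) *\<^sub>R (phase (0 + h n *\<^sub>R (z \<bullet> b)) - phase 0) * fourier u z)
      \<longlonglongrightarrow> frechet_derivative phase (at 0) (z \<bullet> b) * fourier u z"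
    unfolding h_def
  proof (intro tendsto_mult_right frechet_derivative_LIMSEQ)
    show "phase differentiable at 0"
      using phase_deriv by (auto simp: differentiable_def)
  qed
  moreover have "frechet_derivative phase (at 0) (z \<bullet> b)
      = 2 * complex_of_real pi * \<i> * complex_of_real (z \<bullet> b)"
  proof -
    from frechet_derivative_at[OF phase_deriv] show ?thesis by metis
  qed
  ultimately have "(LINT x|lborel. phase (- (z \<bullet> x)) * D x)
      = 2 * complex_of_real pi * \<i> * complex_of_real (z \<bullet> b) * fourier u z"
    using LIMSEQ_unique by auto
  then show ?thesis by (simp add: fourier_phase D_def)
qed

lemma fourier_partials_replicate:
  assumes "\<phi> \<in> schwartz" and b: "b \<in> Basis"
  shows "fourier (partials (replicate m b) \<phi>) z
           = (2 * complex_of_real pi * \<i> * complex_of_real (z \<bullet> b)) ^ m * fourier \<phi> z"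
proof (induction m)
  case (Suc m)
  have bs: "replicate m b \<in> lists Basis" "replicate (Suc m) b \<in> lists Basis"
    using b by auto
  obtain C where C: "\<And>x. norm (partials (replicate (Suc m) b) \<phi> x) \<le> C / decay_weight x"
    using schwartz_decay[OF assms(1) bs(2)] by blast
  have "fourier (partials (replicate (Suc m) b) \<phi>) z
      = 2 * complex_of_real pi * \<i> * complex_of_real (z \<bullet> b) * fourier (partials (replicate m b) \<phi>) z"
    using fourier_frechet_derivative[OF schwartz_differentiable[OF assms(1) bs(1)]
        schwartz_integrable[OF assms(1) bs(1)] b C[unfolded replicate_Suc partials.simps]] by simp
  then show ?case using Suc by (simp add: mult.assoc)
qed simp

text \<open>The derivatives that control the decay of a Fourier transform: none, and the pure one of
  order \<open>2 * DIM('a)\<close> in each direction.\<close>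

definition decay_lists :: "'a::euclidean_space list set" where
  "decay_lists = insert [] ((\<lambda>b. replicate (2 * DIM('a)) b) ` Basis)"

lemma decay_lists: "decay_lists \<subseteq> lists Basis" "finite decay_lists"
  by (auto simp: decay_lists_def)

definition decay_constant :: "'a::euclidean_space itself \<Rightarrow> real" where
  "decay_constant _ = 2 ^ DIM('a) * (1 + DIM('a)) * (LINT x|lborel. 1 / decay_weight (x::'a))"

text \<open>The bound is stated for a difference, with a constant that depends on the dimension alone. With
  \<open>\<psi> = 0\<close> it gives integrability of the transform. Along a convergent sequence it gives continuity,
  and applied to slices it is uniform in the parameter.\<close>

lemma fourier_diff_decay:
  fixes \<phi> \<psi> :: "'a::euclidean_space \<Rightarrow> complex"
  assumes \<phi>: "\<phi> \<in> schwartz" and \<psi>: "\<psi> \<in> schwartz"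
    and bound: "\<And>bs x. bs \<in> decay_lists \<Longrightarrow>
      norm (partials bs \<phi> x - partials bs \<psi> x) \<le> e / decay_weight x"
  shows "norm (fourier \<phi> z - fourier \<psi> z) \<le> decay_constant TYPE('a) * e / decay_weight z"
proof -
  define K where "K = (LINT x|lborel. 1 / decay_weight (x::'a))"
  define \<delta> where "\<delta> = norm (fourier \<phi> z - fourier \<psi> z)"
  have le: "norm (fourier (partials bs \<phi>) z - fourier (partials bs \<psi>) z) \<le> e * K"
    if bs: "bs \<in> decay_lists" for bs
  proof -
    have l: "bs \<in> lists Basis" using bs decay_lists by blast
    note [measurable] = schwartz_measurable[OF \<phi> l] schwartz_measurable[OF \<psi> l]
    have "fourier (partials bs \<phi>) z - fourier (partials bs \<psi>) z
        = (LINT x|lborel. phase (- (z \<bullet> x)) * (partials bs \<phi> x - partials bs \<psi> x))"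
      unfolding fourier_phase right_diff_distrib
      by (rule Bochner_Integration.integral_diff[symmetric])
        (auto intro!: integrable_phase_mult schwartz_integrable \<phi> \<psi> l)
    also have "norm \<dots> \<le> e * K"
      unfolding K_def
      by (rule integrable_decay(2)) (auto simp: norm_mult bound[OF bs])
    finally show ?thesis .
  qed
  have 0: "\<delta> \<le> e * K"
    using le[of "[]"] by (simp add: \<delta>_def decay_lists_def)
  have b: "\<bar>z \<bullet> b\<bar> ^ (2 * DIM('a)) * \<delta> \<le> e * K" if b: "b \<in> Basis" for b
  proof -
    \<comment> \<open>The factor \<open>2 \<pi>\<close> from each derivative only helps, as it is at least \<open>1\<close>.\<close>
    have "\<bar>z \<bullet> b\<bar> ^ (2 * DIM('a)) * \<delta> \<le> (2 * pi * \<bar>z \<bullet> b\<bar>) ^ (2 * DIM('a)) * \<delta>"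
      using pi_ge_two by (intro mult_right_mono power_mono) (auto simp: \<delta>_def mult_le_cancel_right1)
    also have "\<dots> = norm (fourier (partials (replicate (2 * DIM('a)) b) \<phi>) z
        - fourier (partials (replicate (2 * DIM('a)) b) \<psi>) z)"
      unfolding fourier_partials_replicate[OF \<phi> b] fourier_partials_replicate[OF \<psi> b]
      by (simp add: \<delta>_def norm_mult norm_power flip: right_diff_distrib)
    also have "\<dots> \<le> e * K" by (rule le) (use b in \<open>auto simp: decay_lists_def\<close>)
    finally show ?thesis .
  qed
  have "decay_weight z * \<delta> \<le> 2 ^ DIM('a) * (1 + (\<Sum>b\<in>Basis. \<bar>z \<bullet> b\<bar> ^ (2 * DIM('a)))) * \<delta>"
    by (rule mult_right_mono[OF decay_weight_le_coords]) (simp add: \<delta>_def)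
  also have "\<dots> = 2 ^ DIM('a) * (\<delta> + (\<Sum>b\<in>Basis. \<bar>z \<bullet> b\<bar> ^ (2 * DIM('a)) * \<delta>))"
    by (simp add: distrib_right sum_distrib_right mult.assoc)
  also have "\<dots> \<le> 2 ^ DIM('a) * (e * K + (\<Sum>b\<in>(Basis::'a set). e * K))"
    using 0 b by (intro mult_left_mono add_mono sum_mono) auto
  also have "\<dots> = decay_constant TYPE('a) * e"
    by (simp add: decay_constant_def K_def algebra_simps)
  finally show ?thesis
    unfolding \<delta>_def using decay_weight_pos[of z] by (simp add: field_simps)
qed

lemma fourier_decay:
  fixes \<phi> :: "'a::euclidean_space \<Rightarrow> complex"
  assumes "\<phi> \<in> schwartz"
    and "\<And>bs x. bs \<in> decay_lists \<Longrightarrow> norm (partials bs \<phi> x) \<le> e / decay_weight x"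
  shows "norm (fourier \<phi> z) \<le> decay_constant TYPE('a) * e / decay_weight z"
  using fourier_diff_decay[OF assms(1) zero_schwartz, of e z] assms(2)
  by (simp add: partials_zero fourier_phase)

lemma borel_measurable_fourier:
  assumes [measurable]: "F \<in> borel_measurable borel"
  shows "fourier F \<in> borel_measurable borel"
  unfolding fourier_phase[abs_def] by measurable

lemma uniform_decay_bound:
  assumes "finite B" and "\<And>bs. bs \<in> B \<Longrightarrow> \<exists>C. \<forall>x. norm (u bs x) \<le> C / decay_weight x"
  shows "\<exists>C. \<forall>bs\<in>B. \<forall>x. norm (u bs x) \<le> C / decay_weight x"
proof -
  obtain c where c: "\<And>bs x. bs \<in> B \<Longrightarrow> norm (u bs x) \<le> c bs / decay_weight x"
    using assms(2) by metis
  have "norm (u bs x) \<le> (\<Sum>b\<in>B. \<bar>c b\<bar>) / decay_weight x" if "bs \<in> B" for bs x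
  proof -
    have "c bs \<le> (\<Sum>b\<in>B. \<bar>c b\<bar>)"
      using member_le_sum[OF that, of "\<lambda>b. \<bar>c b\<bar>"] assms(1) by force
    then show ?thesis
      using c[OF that, of x] decay_weight_pos[of x]
      by (meson divide_right_mono less_imp_le order_trans)
  qed
  then show ?thesis by blast
qed

lemma integrable_fourier_schwartz:
  fixes \<phi> :: "'a::euclidean_space \<Rightarrow> complex"
  assumes "\<phi> \<in> schwartz"
  shows "integrable lborel (fourier \<phi>)"
proof -
  have "\<exists>C. \<forall>x. norm (partials bs \<phi> x) \<le> C / decay_weight x" if "bs \<in> decay_lists" for bs
    using that decay_lists schwartz_decay[OF assms] by blast
  then obtain C where "\<And>bs x. bs \<in> decay_lists \<Longrightarrow> norm (partials bs \<phi> x) \<le> C / decay_weight x"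
    using uniform_decay_bound[OF decay_lists(2), of "\<lambda>bs. partials bs \<phi>"] by blast
  then have "norm (fourier \<phi> z) \<le> decay_constant TYPE('a) * C / decay_weight z" for z
    by (rule fourier_decay[OF assms])
  moreover have "\<phi> \<in> borel_measurable borel"
    using schwartz_measurable[OF assms, of "[]"] by simp
  ultimately show ?thesis
    by (intro integrable_decay(1) borel_measurable_fourier)
qed

section \<open>Fourier inversion by Gaussian summation\<close>

lemma integrable_lborel_pair_mult:
  fixes f :: "'a::euclidean_space \<Rightarrow> complex" and g :: "'b::euclidean_space \<Rightarrow> complex"
  assumes f: "integrable lborel f" and g: "integrable lborel g"
  shows "integrable (lborel \<Otimes>\<^sub>M lborel) (\<lambda>(x, y). f x * g y)"
proof (rule lborel_pair.Fubini_integrable)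
  have [measurable]: "f \<in> borel_measurable borel" "g \<in> borel_measurable borel"
    using f g by (simp_all add: borel_measurable_integrable)
  show "(\<lambda>(x, y). f x * g y) \<in> borel_measurable (lborel \<Otimes>\<^sub>M lborel)"
    by measurable
  show "integrable lborel (\<lambda>x. LINT y|lborel. norm (case (x, y) of (x, y) \<Rightarrow> f x * g y))"
    using f by (simp add: norm_mult)
  show "AE x in lborel. integrable lborel (\<lambda>y. case (x, y) of (x, y) \<Rightarrow> f x * g y)"
    using g by simp
qed

text \<open>The Gaussian with unit mass, written as a product so that its integrals reduce to dimension one.\<close>

definition std_gauss :: "'a::euclidean_space \<Rightarrow> real" where
  "std_gauss t = (\<Prod>b\<in>Basis. std_normal_density (t \<bullet> b))"

lemma std_gauss_nonneg: "0 \<le> std_gauss t"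
  unfolding std_gauss_def by (rule prod_nonneg) simp

lemma continuous_on_std_gauss: "continuous_on S std_gauss"
  unfolding std_gauss_def std_normal_density_def by (intro continuous_intros) auto

lemma borel_measurable_std_gauss [measurable]: "std_gauss \<in> borel_measurable borel"
  by (rule borel_measurable_continuous_onI[OF continuous_on_std_gauss])

lemma integrable_std_gauss: "integrable lborel std_gauss"
  unfolding std_gauss_def by (rule integrable_lborel_prod(1)) simp

lemma integral_std_gauss: "(LINT t|lborel. std_gauss (t::'a::euclidean_space)) = 1"
  unfolding std_gauss_def by (subst integrable_lborel_prod(2)) simp_all

lemma borel_measurable_cis [measurable]: "cis \<in> borel_measurable borel"
  by (intro borel_measurable_continuous_onI continuous_intros)

lemma cis_inner_eq_prod: "cis (s \<bullet> t) = (\<Prod>b\<in>Basis. cis ((s \<bullet> b) * (t \<bullet> b)))"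
proof -
  have "cis (sum f A) = (\<Prod>b\<in>A. cis (f b))" if "finite A" for f :: "'a \<Rightarrow> real" and A
    using that by induction (auto simp: cis_mult[symmetric])
  then show ?thesis by (subst euclidean_inner) simp
qed

lemma std_gauss_eq_exp:
  "sqrt (2 * pi) ^ DIM('a) * std_gauss (s::'a::euclidean_space) = (\<Prod>b\<in>Basis. exp (- (s \<bullet> b)\<^sup>2 / 2))"
proof -
  have "exp (- (s \<bullet> b)\<^sup>2 / 2) = sqrt (2 * pi) * std_normal_density (s \<bullet> b)" for b
    by (simp add: std_normal_density_def)
  then show ?thesis
    by (simp add: std_gauss_def prod.distrib)
qed

lemma std_gauss_le_1: "sqrt (2 * pi) ^ DIM('a) * std_gauss (s::'a::euclidean_space) \<le> 1"
  unfolding std_gauss_eq_exp by (rule prod_le_1) auto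

text \<open>Up to a factor the Gaussian is its own Fourier transform. The one-dimensional case is the
  characteristic function of the standard normal distribution.\<close>

lemma char_std_gauss:
  fixes s :: "'a::euclidean_space"
  shows "(LINT t|lborel. cis (s \<bullet> t) * complex_of_real (std_gauss t))
           = complex_of_real (sqrt (2 * pi) ^ DIM('a) * std_gauss s)"
proof -
  have int1: "integrable lborel (\<lambda>t. cis (r * t) * complex_of_real (std_normal_density t))" for r
  proof -
    have "integrable lborel (\<lambda>t. complex_of_real (std_normal_density t))" by simp
    then show ?thesis
      by (rule Bochner_Integration.integrable_bound) (auto simp: norm_mult)
  qed
  have eq1: "(LINT t|lborel. cis (r * t) * complex_of_real (std_normal_density t))
      = complex_of_real (exp (- r\<^sup>2 / 2))" for r
  proof -
    have "(LINT t|lborel. cis (r * t) * complex_of_real (std_normal_density t))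
        = char std_normal_distribution r"
      unfolding char_def
      by (subst integral_density) (auto simp: cis_conv_exp scaleR_conv_of_real mult_ac)
    then show ?thesis by (simp add: char_std_normal_distribution)
  qed
  have "(LINT t|lborel. cis (s \<bullet> t) * complex_of_real (std_gauss t)) =
      (LINT t|lborel. (\<Prod>b\<in>Basis. cis ((s \<bullet> b) * (t \<bullet> b)) * complex_of_real (std_normal_density (t \<bullet> b))))"
    by (simp add: cis_inner_eq_prod std_gauss_def prod.distrib)
  also have "\<dots> = (\<Prod>b\<in>Basis. complex_of_real (exp (- (s \<bullet> b)\<^sup>2 / 2)))"
    using integrable_lborel_prod(2)[of "\<lambda>b t. cis ((s \<bullet> b) * t) * complex_of_real (std_normal_density t)"]
    by (simp only: int1 eq1)
  finally show ?thesis by (simp only: std_gauss_eq_exp of_real_prod)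
qed

lemma phase_fourier_std_gauss:
  fixes v :: "'a::euclidean_space"
  assumes e: "0 < e"
  shows "(LINT w|lborel. phase (v \<bullet> w) * complex_of_real (std_gauss (e *\<^sub>R w)))
    = complex_of_real (inverse e ^ DIM('a) * sqrt (2 * pi) ^ DIM('a) * std_gauss ((2 * pi / e) *\<^sub>R v))"
proof -
  let ?F = "\<lambda>s. cis (((2 * pi / e) *\<^sub>R v) \<bullet> s) * complex_of_real (std_gauss s)"
  have "(LINT s|lborel. ?F s) = \<bar>e\<bar> ^ DIM('a) *\<^sub>R (LINT w|lborel. ?F (0 + e *\<^sub>R w))"
    by (rule lborel_affine_substitution(2)) (use e in auto)
  also have "(\<lambda>w. ?F (0 + e *\<^sub>R w)) = (\<lambda>w. phase (v \<bullet> w) * complex_of_real (std_gauss (e *\<^sub>R w)))"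
    using e by (simp add: phase_def)
  finally show ?thesis
    unfolding char_std_gauss using e by (simp add: scaleR_conv_of_real field_simps)
qed

text \<open>Damping the inversion integral by a Gaussian of width \<open>1 / e\<close> averages \<open>h\<close> around \<open>x\<close> against a
  Gaussian of width proportional to \<open>e\<close>. Here Fubini's theorem applies, since the damping makes the
  integrand integrable in both variables; it does not for the undamped integral.\<close>

lemma gauss_mean_eq:
  fixes h :: "'a::euclidean_space \<Rightarrow> complex"
  assumes int: "integrable lborel h" and hint: "integrable lborel (fourier h)" and e: "0 < e"
  shows "(LINT w|lborel. phase (x \<bullet> w) * fourier h w
            * complex_of_real (sqrt (2 * pi) ^ DIM('a) * std_gauss (e *\<^sub>R w)))
       = (LINT t|lborel. h (x + (- (e / (2 * pi))) *\<^sub>R t) * complex_of_real (std_gauss t))"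
proof -
  define k where "k = complex_of_real (sqrt (2 * pi) ^ DIM('a))"
  have [measurable]: "h \<in> borel_measurable borel"
    using int by (simp add: borel_measurable_integrable)
  have g: "integrable lborel (\<lambda>w::'a. complex_of_real (std_gauss (e *\<^sub>R w)))"
    using integrable_std_gauss e
      lborel_affine_substitution(1)[of e "std_gauss :: 'a \<Rightarrow> real" 0]
    by (simp add: complex_of_real_integrable_eq)
  let ?G = "\<lambda>w y. phase ((x - y) \<bullet> w) * (complex_of_real (std_gauss (e *\<^sub>R w)) * (k * h y))"
  have "integrable (lborel \<Otimes>\<^sub>M lborel) (\<lambda>p. phase ((x - snd p) \<bullet> fst p) *
      (case p of (w, y) \<Rightarrow> complex_of_real (std_gauss (e *\<^sub>R w)) * (k * h y)))"
    by (intro integrable_phase_mult integrable_lborel_pair_mult g integrable_mult_right int) measurable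
  also have "(\<lambda>p. phase ((x - snd p) \<bullet> fst p) *
      (case p of (w, y) \<Rightarrow> complex_of_real (std_gauss (e *\<^sub>R w)) * (k * h y))) = (\<lambda>(w, y). ?G w y)"
    by (auto simp: case_prod_beta)
  finally have G: "integrable (lborel \<Otimes>\<^sub>M lborel) (\<lambda>(w, y). ?G w y)" .
  have "(LINT w|lborel. phase (x \<bullet> w) * fourier h w * (k * complex_of_real (std_gauss (e *\<^sub>R w))))
      = (LINT w|lborel. LINT y|lborel. ?G w y)"
  proof (rule Bochner_Integration.integral_cong[OF refl])
    fix w :: 'a
    have G_eq: "?G w y = phase (x \<bullet> w) * k * complex_of_real (std_gauss (e *\<^sub>R w)) * (phase (- (w \<bullet> y)) * h y)" for y
    proof -
      have "phase ((x - y) \<bullet> w) = phase (x \<bullet> w) * phase (- (w \<bullet> y))"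
        by (simp add: phase_add[symmetric] inner_diff_left inner_commute[of y w])
      then show ?thesis by (simp add: mult_ac)
    qed
    show "phase (x \<bullet> w) * fourier h w * (k * complex_of_real (std_gauss (e *\<^sub>R w)))
        = (LINT y|lborel. ?G w y)"
      unfolding G_eq integral_mult_right_zero fourier_phase by (simp add: mult_ac)
  qed
  also have "\<dots> = (LINT y|lborel. LINT w|lborel. ?G w y)"
    by (rule lborel_pair.Fubini_integral[OF G, symmetric])
  also have "\<dots> = (LINT y|lborel. complex_of_real (inverse e ^ DIM('a) * sqrt (2 * pi) ^ DIM('a) *
      std_gauss ((2 * pi / e) *\<^sub>R (x - y))) * (k * h y))"
    by (simp only: mult.assoc[symmetric] integral_mult_left_zero phase_fourier_std_gauss[OF e])
  also have "\<dots> = (LINT y|lborel. complex_of_real ((2 * pi / e) ^ DIM('a)) *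
      (complex_of_real (std_gauss ((2 * pi / e) *\<^sub>R (x - y))) * h y))"
  proof (rule Bochner_Integration.integral_cong[OF refl])
    fix y
    have "inverse e ^ DIM('a) * sqrt (2 * pi) ^ DIM('a) * sqrt (2 * pi) ^ DIM('a) = (2 * pi / e) ^ DIM('a)"
      by (simp flip: power_mult_distrib add: divide_inverse mult_ac)
    note this[symmetric]
    then show "complex_of_real (inverse e ^ DIM('a) * sqrt (2 * pi) ^ DIM('a) *
        std_gauss ((2 * pi / e) *\<^sub>R (x - y))) * (k * h y) =
      complex_of_real ((2 * pi / e) ^ DIM('a)) *
        (complex_of_real (std_gauss ((2 * pi / e) *\<^sub>R (x - y))) * h y)"
      by (simp only: k_def of_real_mult mult_ac)
  qed
  also have "\<dots> = (LINT t|lborel. h (x + (- (e / (2 * pi))) *\<^sub>R t) * complex_of_real (std_gauss t))"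
  proof -
    \<comment> \<open>The substitution \<open>y = x - (e / 2\<pi>) t\<close> makes the argument of the Gaussian equal to \<open>t\<close>.\<close>
    let ?F = "\<lambda>y. complex_of_real ((2 * pi / e) ^ DIM('a)) *
      (complex_of_real (std_gauss ((2 * pi / e) *\<^sub>R (x - y))) * h y)"
    have "(LINT y|lborel. ?F y) = \<bar>- (e / (2 * pi))\<bar> ^ DIM('a) *\<^sub>R
        (LINT t|lborel. ?F (x + (- (e / (2 * pi))) *\<^sub>R t))"
      by (rule lborel_affine_substitution(2)) (use e in auto)
    also have "\<dots> = (LINT t|lborel. \<bar>- (e / (2 * pi))\<bar> ^ DIM('a) *\<^sub>R ?F (x + (- (e / (2 * pi))) *\<^sub>R t))"
      by (rule integral_scaleR_right[symmetric])
    also have "\<dots> = (LINT t|lborel. h (x + (- (e / (2 * pi))) *\<^sub>R t) * complex_of_real (std_gauss t))"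
    proof (rule Bochner_Integration.integral_cong[OF refl])
      fix t :: 'a
      have 1: "\<bar>- (e / (2 * pi))\<bar> ^ DIM('a) * (2 * pi / e) ^ DIM('a) = 1"
        using e by (simp flip: power_mult_distrib)
      have 2: "(2 * pi / e) *\<^sub>R (x - (x + (- (e / (2 * pi))) *\<^sub>R t)) = t"
        using e by simp
      have "\<bar>- (e / (2 * pi))\<bar> ^ DIM('a) *\<^sub>R ?F (x + (- (e / (2 * pi))) *\<^sub>R t)
        = complex_of_real (\<bar>- (e / (2 * pi))\<bar> ^ DIM('a) * (2 * pi / e) ^ DIM('a)) *
          (complex_of_real (std_gauss t) * h (x + (- (e / (2 * pi))) *\<^sub>R t))"
        unfolding 2 by (simp only: scaleR_conv_of_real of_real_mult mult.assoc)
      then show "\<bar>- (e / (2 * pi))\<bar> ^ DIM('a) *\<^sub>R ?F (x + (- (e / (2 * pi))) *\<^sub>R t)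
        = h (x + (- (e / (2 * pi))) *\<^sub>R t) * complex_of_real (std_gauss t)"
        unfolding 1 by (simp add: mult.commute)
    qed
    finally show ?thesis .
  qed
  finally show ?thesis unfolding k_def by (simp only: of_real_mult)
qed

text \<open>As \<open>e\<close> tends to \<open>0\<close> the damped integral converges to the inversion integral, as the transform is
  integrable, and the Gaussian average converges to \<open>h x\<close>, as \<open>h\<close> is bounded and continuous.\<close>

theorem fourier_inversion:
  fixes h :: "'a::euclidean_space \<Rightarrow> complex"
  assumes int: "integrable lborel h" and hint: "integrable lborel (fourier h)"
    and cont: "continuous_on UNIV h" and bound: "\<And>x. norm (h x) \<le> B"
  shows "(LINT w|lborel. phase (x \<bullet> w) * fourier h w) = h x"
proof -
  define e where "e n = inverse (real (Suc n))" for n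
  have e: "0 < e n" for n by (simp add: e_def)
  have e0: "e \<longlonglongrightarrow> 0" unfolding e_def by (rule LIMSEQ_inverse_real_of_nat)
  have [measurable]: "h \<in> borel_measurable borel" "fourier h \<in> borel_measurable borel"
    using int hint by (simp_all add: borel_measurable_integrable)
  let ?c = "sqrt (2 * pi) ^ DIM('a)"
  let ?L = "\<lambda>n w. phase (x \<bullet> w) * fourier h w * complex_of_real (?c * std_gauss (e n *\<^sub>R w))"
  let ?R = "\<lambda>n t. h (x + (- (e n / (2 * pi))) *\<^sub>R t) * complex_of_real (std_gauss t)"
  have gauss0: "?c * std_gauss (0::'a) = 1"
    by (subst std_gauss_eq_exp) simp
  have gauss_cont: "(\<lambda>n. std_gauss (e n *\<^sub>R w)) \<longlonglongrightarrow> std_gauss (0::'a)" for w :: 'a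
  proof -
    have "isCont std_gauss (0::'a)"
      using continuous_on_std_gauss[of "UNIV::'a set"] by (simp add: continuous_on_eq_continuous_at)
    moreover have "(\<lambda>n. e n *\<^sub>R w) \<longlonglongrightarrow> 0"
      using tendsto_scaleR[OF e0 tendsto_const[of w]] by simp
    ultimately show ?thesis by (rule isCont_tendsto_compose)
  qed
  have lhs: "(\<lambda>n. LINT w|lborel. ?L n w) \<longlonglongrightarrow> (LINT w|lborel. phase (x \<bullet> w) * fourier h w * complex_of_real 1)"
  proof (rule integral_dominated_convergence[where w = "\<lambda>w. norm (fourier h w)"])
    show "AE w in lborel. (\<lambda>n. ?L n w) \<longlonglongrightarrow> phase (x \<bullet> w) * fourier h w * complex_of_real 1"
      unfolding gauss0[symmetric] by (intro AE_I2 tendsto_intros gauss_cont)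
    show "AE w in lborel. norm (?L n w) \<le> norm (fourier h w)" for n
    proof (rule AE_I2)
      fix w :: 'a
      have "\<bar>?c * std_gauss (e n *\<^sub>R w)\<bar> \<le> 1"
        using std_gauss_le_1[of "e n *\<^sub>R w"] std_gauss_nonneg[of "e n *\<^sub>R w"] by simp
      then show "norm (?L n w) \<le> norm (fourier h w)"
        unfolding norm_mult norm_of_real norm_phase
        using mult_left_le[of _ "norm (fourier h w)"] by simp
    qed
  qed (use hint in simp_all)
  have rhs: "(\<lambda>n. LINT t|lborel. ?R n t) \<longlonglongrightarrow> (LINT t|lborel. h x * complex_of_real (std_gauss (t::'a)))"
  proof (rule integral_dominated_convergence[where w = "\<lambda>t::'a. B * std_gauss t"])
    show "AE t in lborel. (\<lambda>n. ?R n t) \<longlonglongrightarrow> h x * complex_of_real (std_gauss t)"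
    proof (intro AE_I2 tendsto_mult tendsto_const)
      fix t :: 'a
      have "(\<lambda>n. x + (- (e n / (2 * pi))) *\<^sub>R t) \<longlonglongrightarrow> x + (- (0 / (2 * pi))) *\<^sub>R t"
        by (intro tendsto_intros e0) simp
      then have "(\<lambda>n. x + (- (e n / (2 * pi))) *\<^sub>R t) \<longlonglongrightarrow> x" by simp
      moreover have "isCont h x" using cont by (simp add: continuous_on_eq_continuous_at)
      ultimately show "(\<lambda>n. h (x + (- (e n / (2 * pi))) *\<^sub>R t)) \<longlonglongrightarrow> h x"
        by (rule isCont_tendsto_compose[rotated])
    qed
    show "AE t in lborel. norm (?R n t) \<le> B * std_gauss t" for n
      using bound by (intro AE_I2) (simp add: norm_mult mult_right_mono abs_of_nonneg[OF std_gauss_nonneg] std_gauss_nonneg)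
  qed (simp_all add: integrable_std_gauss)
  have mean: "(LINT t|lborel. h x * complex_of_real (std_gauss (t::'a))) = h x"
    by (simp add: integral_std_gauss integral_complex_of_real)
  have eq: "(LINT w|lborel. ?L n w) = (LINT t|lborel. ?R n t)" for n
    by (rule gauss_mean_eq[OF int hint e])
  show ?thesis
    using LIMSEQ_unique[OF lhs[unfolded eq] rhs] unfolding mean by simp
qed

section \<open>Membership in the Schwartz space\<close>

text \<open>A set of rapidly decreasing differentiable functions that is closed under partial derivatives
  consists of Schwartz functions. This replaces product and chain rules of higher order: one only
  has to find a closed set that contains the given function.\<close>

lemma schwartzI_closed:
  fixes S :: "('a::euclidean_space \<Rightarrow> complex) set"
  assumes "u \<in> S"
    and diff: "\<And>v x. v \<in> S \<Longrightarrow> v differentiable (at x)"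
    and closed: "\<And>v b. v \<in> S \<Longrightarrow> b \<in> Basis \<Longrightarrow> (\<lambda>x. frechet_derivative v (at x) b) \<in> S"
    and bound: "\<And>v k. v \<in> S \<Longrightarrow> \<exists>C. \<forall>x. norm x ^ k * norm (v x) \<le> C"
  shows "u \<in> schwartz"
proof -
  have S: "partials bs u \<in> S" if "bs \<in> lists Basis" for bs
    using that by (induction bs) (auto intro: assms)
  then have "bounded (range (\<lambda>x. norm x ^ k *\<^sub>R partials bs u x))" if "bs \<in> lists Basis" for bs k
    using bound[OF S[OF that], of k] by (auto simp: bounded_iff)
  with S show ?thesis by (auto simp: schwartz_def smooth_def intro: diff)
qed

lemma frechet_derivative_basis_sum:
  fixes F :: "'a::euclidean_space \<Rightarrow> 'b::real_normed_vector"
  assumes "F differentiable (at x)"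
  shows "frechet_derivative F (at x) w = (\<Sum>b\<in>Basis. (w \<bullet> b) *\<^sub>R frechet_derivative F (at x) b)"
proof -
  interpret bounded_linear "frechet_derivative F (at x)"
    using assms frechet_derivative_works has_derivative_bounded_linear by blast
  have "frechet_derivative F (at x) (\<Sum>b\<in>Basis. (w \<bullet> b) *\<^sub>R b)
      = (\<Sum>b\<in>Basis. (w \<bullet> b) *\<^sub>R frechet_derivative F (at x) b)"
    by (simp only: sum scaleR)
  then show ?thesis by (simp add: euclidean_representation)
qed

text \<open>A partial derivative of \<open>f (L z) * cnj (g (R z))\<close> is a linear combination of such products for
  derivatives of \<open>f\<close> and \<open>g\<close>: the product rule gives a sum, and \<open>L\<close> and \<open>R\<close> map a basis vector to a
  combination of basis vectors. The constant \<open>c\<close> and the sums make the set closed under derivatives.\<close>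

inductive_set tensor_span ::
  "('a::euclidean_space \<Rightarrow> complex) \<Rightarrow> ('b::euclidean_space \<Rightarrow> complex) \<Rightarrow>
    ('c::euclidean_space \<Rightarrow> 'a) \<Rightarrow> ('c \<Rightarrow> 'b) \<Rightarrow> ('c \<Rightarrow> complex) set"
  for f g L R where
  tensor: "bs \<in> lists Basis \<Longrightarrow> cs \<in> lists Basis \<Longrightarrow>
    (\<lambda>z. c * (partials bs f (L z) * cnj (partials cs g (R z)))) \<in> tensor_span f g L R"
| add: "u \<in> tensor_span f g L R \<Longrightarrow> v \<in> tensor_span f g L R \<Longrightarrow>
    (\<lambda>z. u z + v z) \<in> tensor_span f g L R"

lemma tensor_span_sum:
  assumes "finite A" and "\<And>i. i \<in> A \<Longrightarrow> u i \<in> tensor_span f g L R"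
  shows "(\<lambda>z. \<Sum>i\<in>A. u i z) \<in> tensor_span f g L R"
  using assms
proof (induction A)
  case empty
  show ?case using tensor_span.tensor[of "[]" "[]" 0] by simp
next
  case (insert i A)
  then show ?case by (simp add: tensor_span.add)
qed

lemma tensor_span_derivative:
  assumes f: "f \<in> schwartz" and g: "g \<in> schwartz" and L: "bounded_linear L" and R: "bounded_linear R"
    and "u \<in> tensor_span f g L R"
  shows "\<exists>D. (\<forall>x. (u has_derivative (\<lambda>v. D v x)) (at x)) \<and> (\<forall>v. D v \<in> tensor_span f g L R)"
  using assms(5)
proof induction
  case (tensor bs cs c)
  let ?F = "partials bs f" and ?G = "partials cs g"
  have F: "?F differentiable (at x)" for x by (rule schwartz_differentiable[OF f tensor(1)])
  have G: "?G differentiable (at x)" for x by (rule schwartz_differentiable[OF g tensor(2)])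
  define D where "D v z =
      (\<Sum>b\<in>Basis. c * (L v \<bullet> b) * (partials (b # bs) f (L z) * cnj (?G (R z)))) +
      (\<Sum>b\<in>Basis. c * (R v \<bullet> b) * (?F (L z) * cnj (partials (b # cs) g (R z))))" for v z
  have "((\<lambda>z. c * (?F (L z) * cnj (?G (R z)))) has_derivative (\<lambda>v. D v z)) (at z)" for z
  proof -
    have 1: "((\<lambda>z. ?F (L z)) has_derivative (\<lambda>v. frechet_derivative ?F (at (L z)) (L v))) (at z)"
      by (rule has_derivative_compose[OF bounded_linear_imp_has_derivative[OF L]])
        (use F frechet_derivative_works in blast)
    have 2: "((\<lambda>z. ?G (R z)) has_derivative (\<lambda>v. frechet_derivative ?G (at (R z)) (R v))) (at z)"
      by (rule has_derivative_compose[OF bounded_linear_imp_has_derivative[OF R]])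
        (use G frechet_derivative_works in blast)
    have 3: "((\<lambda>z. cnj (?G (R z))) has_derivative (\<lambda>v. cnj (frechet_derivative ?G (at (R z)) (R v)))) (at z)"
      by (rule bounded_linear.has_derivative[OF bounded_linear_cnj 2])
    have "((\<lambda>z. c * (?F (L z) * cnj (?G (R z)))) has_derivative
       (\<lambda>v. c * (?F (L z) * cnj (frechet_derivative ?G (at (R z)) (R v)) +
          frechet_derivative ?F (at (L z)) (L v) * cnj (?G (R z))))) (at z)"
      by (rule has_derivative_mult_right[OF has_derivative_mult[OF 1 3]])
    also have "(\<lambda>v. c * (?F (L z) * cnj (frechet_derivative ?G (at (R z)) (R v)) +
          frechet_derivative ?F (at (L z)) (L v) * cnj (?G (R z)))) = (\<lambda>v. D v z)"
    proof
      fix v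
      show "c * (?F (L z) * cnj (frechet_derivative ?G (at (R z)) (R v)) +
          frechet_derivative ?F (at (L z)) (L v) * cnj (?G (R z))) = D v z"
        unfolding D_def frechet_derivative_basis_sum[OF F, of "L z" "L v"]
          frechet_derivative_basis_sum[OF G, of "R z" "R v"]
        by (simp add: scaleR_conv_of_real sum_distrib_left sum_distrib_right distrib_left mult_ac)
    qed
    finally show ?thesis .
  qed
  moreover have "D v \<in> tensor_span f g L R" for v
    unfolding D_def
    by (intro tensor_span.add tensor_span_sum tensor_span.tensor) (use tensor in auto)
  ultimately show ?case by blast
next
  case (add u v)
  then obtain D E where
    "\<And>x. (u has_derivative (\<lambda>v. D v x)) (at x)" "\<And>v. D v \<in> tensor_span f g L R"
    "\<And>x. (v has_derivative (\<lambda>v. E v x)) (at x)" "\<And>v. E v \<in> tensor_span f g L R"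
    by blast
  then show ?case
    by (intro exI[of _ "\<lambda>w x. D w x + E w x"]) (auto intro: has_derivative_add tensor_span.add)
qed

text \<open>The two factors decay in \<open>L z\<close> and in \<open>R z\<close> respectively. Together these control \<open>z\<close>.\<close>

lemma tensor_span_bound:
  assumes f: "f \<in> schwartz" and g: "g \<in> schwartz"
    and K: "\<And>z. norm z \<le> K * (norm (L z) + norm (R z))"
    and "u \<in> tensor_span f g L R"
  shows "\<exists>C. \<forall>z. norm z ^ k * norm (u z) \<le> C"
  using assms(4)
proof induction
  case (tensor bs cs c)
  let ?F = "partials bs f" and ?G = "partials cs g"
  obtain F0 where F0: "\<And>x. norm x ^ 0 * norm (?F x) \<le> F0"
    using schwartz_bounds[OF f tensor(1)] by blast
  obtain Fk where Fk: "\<And>x. norm x ^ k * norm (?F x) \<le> Fk"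
    using schwartz_bounds[OF f tensor(1)] by blast
  obtain G0 where G0: "\<And>x. norm x ^ 0 * norm (?G x) \<le> G0"
    using schwartz_bounds[OF g tensor(2)] by blast
  obtain Gk where Gk: "\<And>x. norm x ^ k * norm (?G x) \<le> Gk"
    using schwartz_bounds[OF g tensor(2)] by blast
  have nonneg: "0 \<le> F0" "0 \<le> Fk"
    using F0[of 0] Fk[of 0] norm_ge_zero[of "?F 0"] zero_le_power[OF norm_ge_zero, of "0::'a" k]
    by (auto intro: order_trans[rotated] mult_nonneg_nonneg)
  have "norm z ^ k * norm (c * (?F (L z) * cnj (?G (R z))))
      \<le> norm c * (2 * \<bar>K\<bar>) ^ k * (Fk * G0 + F0 * Gk)" for z
  proof -
    let ?l = "norm (L z)" and ?r = "norm (R z)"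
    have "norm z \<le> \<bar>K\<bar> * (?l + ?r)"
      by (rule order_trans[OF K]) (intro mult_right_mono, auto)
    also have "\<dots> \<le> \<bar>K\<bar> * (2 * max ?l ?r)"
      by (intro mult_left_mono) auto
    finally have "norm z ^ k \<le> (2 * \<bar>K\<bar> * max ?l ?r) ^ k"
      by (intro power_mono) (auto simp: mult_ac)
    also have "\<dots> = (2 * \<bar>K\<bar>) ^ k * max ?l ?r ^ k"
      by (simp add: power_mult_distrib)
    also have "\<dots> \<le> (2 * \<bar>K\<bar>) ^ k * (?l ^ k + ?r ^ k)"
      by (intro mult_left_mono) (auto simp: max_def)
    finally have "norm z ^ k * norm (c * (?F (L z) * cnj (?G (R z))))
        \<le> (2 * \<bar>K\<bar>) ^ k * (?l ^ k + ?r ^ k) * norm (c * (?F (L z) * cnj (?G (R z))))"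
      by (rule mult_right_mono) simp
    also have "\<dots> = norm c * (2 * \<bar>K\<bar>) ^ k * ((?l ^ k * norm (?F (L z))) * norm (?G (R z)) +
        norm (?F (L z)) * (?r ^ k * norm (?G (R z))))"
      by (simp add: norm_mult algebra_simps)
    also have "\<dots> \<le> norm c * (2 * \<bar>K\<bar>) ^ k * (Fk * G0 + F0 * Gk)"
      using F0 Fk G0 Gk nonneg by (intro mult_left_mono add_mono mult_mono) auto
    finally show ?thesis .
  qed
  then show ?case by blast
next
  case (add u v)
  then obtain C1 C2 where "\<And>z. norm z ^ k * norm (u z) \<le> C1" "\<And>z. norm z ^ k * norm (v z) \<le> C2"
    by blast
  then have "norm z ^ k * norm (u z + v z) \<le> C1 + C2" for z
    by (smt (verit) mult_left_mono distrib_left norm_triangle_ineq norm_ge_zero zero_le_power)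
  then show ?case by blast
qed

text \<open>Joint injectivity of \<open>L\<close> and \<open>R\<close> is what makes the product decay in every direction; in finite
  dimension it bounds \<open>norm z\<close> by a multiple of \<open>norm (L z) + norm (R z)\<close>.\<close>

theorem schwartz_tensor_linear:
  fixes L :: "'c::euclidean_space \<Rightarrow> 'a::euclidean_space" and R :: "'c \<Rightarrow> 'b::euclidean_space"
  assumes f: "f \<in> schwartz" and g: "g \<in> schwartz" and L: "linear L" and R: "linear R"
    and inj: "\<And>z. L z = 0 \<Longrightarrow> R z = 0 \<Longrightarrow> z = 0"
  shows "(\<lambda>z. f (L z) * cnj (g (R z))) \<in> schwartz"
proof (rule schwartzI_closed[where S = "tensor_span f g L R"])
  have bl: "bounded_linear L" "bounded_linear R"
    using L R by (simp_all add: linear_conv_bounded_linear)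
  show "(\<lambda>z. f (L z) * cnj (g (R z))) \<in> tensor_span f g L R"
    using tensor_span.tensor[of "[]" "[]" 1 f L g R] by simp
  have "linear (\<lambda>z. (L z, R z))"
    using bounded_linear_Pair[OF bl] by (rule bounded_linear.linear)
  moreover have "inj (\<lambda>z. (L z, R z))"
    using inj calculation by (simp add: linear_injective_0 zero_prod_def)
  ultimately obtain B where "B > 0" and B: "\<And>z. B * norm z \<le> norm (L z, R z)"
    using linear_inj_bounded_below_pos by blast
  have K: "norm z \<le> (1 / B) * (norm (L z) + norm (R z))" for z
  proof -
    have "B * norm z \<le> norm (L z) + norm (R z)"
      using B[of z] norm_Pair_le[of "L z" "R z"] by linarith
    then show ?thesis using \<open>B > 0\<close> by (simp add: field_simps)
  qed
  fix v assume v: "v \<in> tensor_span f g L R"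
  obtain D where D: "\<And>x. (v has_derivative (\<lambda>w. D w x)) (at x)" "\<And>w. D w \<in> tensor_span f g L R"
    using tensor_span_derivative[OF f g bl v] by blast
  show "v differentiable (at x)" for x
    using D(1) by (auto simp: differentiable_def)
  have "(\<lambda>x. frechet_derivative v (at x) b) = D b" for b
  proof
    fix x
    show "frechet_derivative v (at x) b = D b x"
      using frechet_derivative_at[OF D(1)[of x]] by metis
  qed
  then show "(\<lambda>x. frechet_derivative v (at x) b) \<in> tensor_span f g L R" for b
    using D(2) by simp
  show "\<exists>C. \<forall>z. norm z ^ k * norm (v z) \<le> C" for k
    by (rule tensor_span_bound[OF f g K v])
qed

text \<open>For a Gaussian \<open>w\<close> this set, which consists of the products of \<open>w\<close> with polynomials, is closed
  under partial derivatives.\<close>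

inductive_set polynomial_multiples :: "('a::euclidean_space \<Rightarrow> complex) \<Rightarrow> ('a \<Rightarrow> complex) set"
  for w where
  base: "w \<in> polynomial_multiples w"
| coord: "u \<in> polynomial_multiples w \<Longrightarrow> (\<lambda>x. complex_of_real (x \<bullet> b) * u x) \<in> polynomial_multiples w"
| scale: "u \<in> polynomial_multiples w \<Longrightarrow> (\<lambda>x. c * u x) \<in> polynomial_multiples w"
| add: "u \<in> polynomial_multiples w \<Longrightarrow> v \<in> polynomial_multiples w \<Longrightarrow>
    (\<lambda>x. u x + v x) \<in> polynomial_multiples w"

lemma polynomial_multiples_derivative:
  assumes w: "\<And>x. (w has_derivative (\<lambda>v. E v x)) (at x)" "\<And>v. E v \<in> polynomial_multiples w"
    and "u \<in> polynomial_multiples w"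
  shows "\<exists>D. (\<forall>x. (u has_derivative (\<lambda>v. D v x)) (at x)) \<and> (\<forall>v. D v \<in> polynomial_multiples w)"
  using assms(3)
proof induction
  case base
  then show ?case using w by blast
next
  case (coord u b)
  then obtain D where D: "\<And>x. (u has_derivative (\<lambda>v. D v x)) (at x)" "\<And>v. D v \<in> polynomial_multiples w"
    by blast
  have "((\<lambda>x. complex_of_real (x \<bullet> b) * u x) has_derivative
      (\<lambda>v. complex_of_real (x \<bullet> b) * D v x + complex_of_real (v \<bullet> b) * u x)) (at x)" for x
  proof (rule has_derivative_mult[OF _ D(1)])
    have "bounded_linear (\<lambda>x. complex_of_real (x \<bullet> b))"
      by (intro bounded_linear_compose[OF bounded_linear_of_real] bounded_linear_inner_left)
    then show "((\<lambda>x. complex_of_real (x \<bullet> b)) has_derivative (\<lambda>v. complex_of_real (v \<bullet> b))) (at x)"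
      by (rule bounded_linear_imp_has_derivative)
  qed
  then show ?case
    using D(2) coord(1)
    by (intro exI[of _ "\<lambda>v x. complex_of_real (x \<bullet> b) * D v x + complex_of_real (v \<bullet> b) * u x"])
      (auto intro!: polynomial_multiples.intros)
next
  case (scale u c)
  then obtain D where "\<And>x. (u has_derivative (\<lambda>v. D v x)) (at x)" "\<And>v. D v \<in> polynomial_multiples w"
    by blast
  then show ?case
    by (intro exI[of _ "\<lambda>v x. c * D v x"]) (auto intro: has_derivative_mult_right polynomial_multiples.scale)
next
  case (add u v)
  then obtain D E where
    "\<And>x. (u has_derivative (\<lambda>v. D v x)) (at x)" "\<And>v. D v \<in> polynomial_multiples w"
    "\<And>x. (v has_derivative (\<lambda>v. E v x)) (at x)" "\<And>v. E v \<in> polynomial_multiples w"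
    by blast
  then show ?case
    by (intro exI[of _ "\<lambda>w x. D w x + E w x"]) (auto intro: has_derivative_add polynomial_multiples.add)
qed

lemma polynomial_multiples_bound:
  assumes w: "\<And>k. \<exists>C. \<forall>x. norm x ^ k * norm (w x) \<le> C" and "u \<in> polynomial_multiples w"
  shows "\<exists>C. \<forall>x. norm x ^ k * norm (u x) \<le> C"
  using assms(2)
proof (induction arbitrary: k)
  case base
  then show ?case by (rule w)
next
  case (coord u b)
  then obtain C where C: "\<And>x. norm x ^ Suc k * norm (u x) \<le> C" by blast
  have "norm x ^ k * norm (complex_of_real (x \<bullet> b) * u x) \<le> norm b * C" for x
  proof -
    have "norm x ^ k * norm (complex_of_real (x \<bullet> b) * u x) \<le> norm x ^ k * ((norm x * norm b) * norm (u x))"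
      unfolding norm_mult norm_of_real
      by (intro mult_left_mono mult_right_mono Cauchy_Schwarz_ineq2) auto
    also have "\<dots> = norm b * (norm x ^ Suc k * norm (u x))" by simp
    also have "\<dots> \<le> norm b * C" by (intro mult_left_mono C) simp
    finally show ?thesis .
  qed
  then show ?case by blast
next
  case (scale u c)
  then obtain C where C: "\<And>x. norm x ^ k * norm (u x) \<le> C" by blast
  have "norm x ^ k * norm (c * u x) \<le> norm c * C" for x
    using mult_left_mono[OF C[of x], of "norm c"] by (simp add: norm_mult mult_ac)
  then show ?case by blast
next
  case (add u v)
  obtain C1 C2 where "\<And>z. norm z ^ k * norm (u z) \<le> C1" "\<And>z. norm z ^ k * norm (v z) \<le> C2"
    using add.IH[of k] by blast
  then have "norm z ^ k * norm (u z + v z) \<le> C1 + C2" for z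
    by (smt (verit) mult_left_mono distrib_left norm_triangle_ineq norm_ge_zero zero_le_power)
  then show ?case by blast
qed

lemma exp_minus_norm_square_bound:
  fixes w :: "'a::real_normed_vector \<Rightarrow> complex"
  assumes "\<And>x. norm (w x) \<le> exp (a + K * norm x - (norm x)\<^sup>2)"
  shows "\<exists>C. \<forall>x. norm x ^ k * norm (w x) \<le> C"
proof (intro exI allI)
  fix x :: 'a
  have "norm x ^ k / fact k \<le> exp (norm x)"
  proof -
    have "(\<Sum>n\<in>{k}. norm x ^ n /\<^sub>R fact n) \<le> exp (norm x)"
      unfolding exp_def
      by (rule sum_le_suminf[OF summable_exp_generic]) auto
    then show ?thesis by (simp add: field_simps)
  qed
  then have "norm x ^ k \<le> fact k * exp (norm x)"
    by (simp add: field_simps)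
  then have "norm x ^ k * norm (w x) \<le> (fact k * exp (norm x)) * exp (a + K * norm x - (norm x)\<^sup>2)"
    by (intro mult_mono assms) auto
  also have "\<dots> = fact k * exp (a + (K + 1) * norm x - (norm x)\<^sup>2)"
    by (simp add: mult_exp_exp algebra_simps)
  also have "\<dots> \<le> fact k * exp (a + (K + 1)\<^sup>2)"
  proof -
    have "m * t - t\<^sup>2 \<le> m\<^sup>2" for m t :: real
    proof -
      have "0 \<le> (m - t)\<^sup>2 + m\<^sup>2 + t\<^sup>2" by simp
      then show ?thesis by (simp add: power2_eq_square algebra_simps)
    qed
    from this[of "K + 1" "norm x"]
    have "(K + 1) * norm x - (norm x)\<^sup>2 \<le> (K + 1)\<^sup>2" .
    then show ?thesis by simp
  qed
  finally show "norm x ^ k * norm (w x) \<le> fact k * exp (a + (K + 1)\<^sup>2)" .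
qed

text \<open>The affine exponent covers all translates and modulations of the Gaussian.\<close>

theorem schwartz_gaussian:
  fixes l :: "'a::euclidean_space \<Rightarrow> complex"
  assumes l: "linear l"
  shows "(\<lambda>x. exp (c - complex_of_real (x \<bullet> x) + l x)) \<in> schwartz" (is "?w \<in> _")
proof (rule schwartzI_closed[where S = "polynomial_multiples ?w"])
  have bl: "bounded_linear l"
    using l by (simp add: linear_conv_bounded_linear)
  define E where "E v x = (\<Sum>b\<in>Basis. (- 2 * complex_of_real (v \<bullet> b)) * (complex_of_real (x \<bullet> b) * ?w x))
      + l v * ?w x" for v x
  have E1: "(?w has_derivative (\<lambda>v. E v x)) (at x)" for x
  proof -
    have "((\<lambda>x. c - complex_of_real (x \<bullet> x) + l x) has_derivative
        (\<lambda>v. 0 - complex_of_real (x \<bullet> v + v \<bullet> x) + l v)) (at x)"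
      by (intro has_derivative_add has_derivative_diff has_derivative_const
          bounded_linear.has_derivative[OF bounded_linear_of_real]
          bounded_linear.has_derivative[OF bl] has_derivative_ident has_derivative_inner)
    moreover have "(exp has_derivative ((*) (exp y))) (at y)" for y :: complex
      using DERIV_exp[of y] by (simp add: has_field_derivative_def)
    ultimately have "(?w has_derivative (\<lambda>v. ?w x * (0 - complex_of_real (x \<bullet> v + v \<bullet> x) + l v))) (at x)"
      by (rule has_derivative_compose)
    also have "(\<lambda>v. ?w x * (0 - complex_of_real (x \<bullet> v + v \<bullet> x) + l v)) = (\<lambda>v. E v x)"
    proof
      fix v
      have "complex_of_real (x \<bullet> v + v \<bullet> x) = (\<Sum>b\<in>Basis. 2 * complex_of_real (v \<bullet> b) * complex_of_real (x \<bullet> b))"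
        by (subst (1 2) euclidean_inner) (simp add: mult_ac sum_distrib_left sum.distrib[symmetric])
      then show "?w x * (0 - complex_of_real (x \<bullet> v + v \<bullet> x) + l v) = E v x"
        unfolding E_def by (simp add: sum_distrib_left sum_negf algebra_simps)
    qed
    finally show ?thesis .
  qed
  have sum: "(\<lambda>x. \<Sum>b\<in>A. u b x) \<in> polynomial_multiples ?w"
    if "finite A" "\<And>b. u b \<in> polynomial_multiples ?w" for A and u :: "'a \<Rightarrow> 'a \<Rightarrow> complex"
    using that(1)
  proof (induction A)
    case empty
    then show ?case using polynomial_multiples.scale[OF that(2), of 0] by simp
  next
    case (insert b A)
    then show ?case using polynomial_multiples.add[OF that(2)] by simp
  qed
  have E2: "E v \<in> polynomial_multiples ?w" for v
    unfolding E_def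
    by (intro polynomial_multiples.add sum polynomial_multiples.scale polynomial_multiples.coord
        polynomial_multiples.base finite_Basis)
  show "?w \<in> polynomial_multiples ?w" by (rule polynomial_multiples.base)
  fix v assume v: "v \<in> polynomial_multiples ?w"
  obtain D where D: "\<And>x. (v has_derivative (\<lambda>w. D w x)) (at x)" "\<And>u. D u \<in> polynomial_multiples ?w"
    using polynomial_multiples_derivative[OF E1 E2 v] by blast
  show "v differentiable (at x)" for x
    using D(1) by (auto simp: differentiable_def)
  have "(\<lambda>x. frechet_derivative v (at x) b) = D b" for b
  proof
    fix x
    show "frechet_derivative v (at x) b = D b x"
      using frechet_derivative_at[OF D(1)[of x]] by metis
  qed
  then show "(\<lambda>x. frechet_derivative v (at x) b) \<in> polynomial_multiples ?w" for b
    using D(2) by simp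
  obtain K where K: "\<And>x. norm (l x) \<le> norm x * K"
    using bounded_linear.bounded[OF bl] by blast
  have "norm (?w x) \<le> exp (Re c + K * norm x - (norm x)\<^sup>2)" for x
    using K[of x] complex_Re_le_cmod[of "l x"] by (simp add: power2_norm_eq_inner mult.commute)
  from exp_minus_norm_square_bound[OF this]
  have "\<exists>C. \<forall>x. norm x ^ k * norm (?w x) \<le> C" for k .
  from polynomial_multiples_bound[OF this v]
  show "\<exists>C. \<forall>x. norm x ^ k * norm (v x) \<le> C" for k .
qed

text \<open>Partial derivatives of a slice are partial derivatives of the whole function in the directions
  \<open>(0, b)\<close>, so bounds for them are uniform in \<open>x\<close>.\<close>

lemma partials_slice:
  fixes H :: "'a::euclidean_space \<times> 'b::euclidean_space \<Rightarrow> complex"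
  assumes H: "H \<in> schwartz" and "bs \<in> lists Basis"
  shows "partials bs (\<lambda>y. H (x, y)) = (\<lambda>y. partials (map (Pair 0) bs) H (x, y))"
    and "partials bs (\<lambda>y. H (x, y)) differentiable (at y)"
proof -
  have der: "((\<lambda>y. F (x, y)) has_derivative (\<lambda>v. frechet_derivative F (at (x, y)) (0, v))) (at y)"
    if "F differentiable (at (x, y))" for F :: "'a \<times> 'b \<Rightarrow> complex" and y
  proof -
    have "((\<lambda>y. (x, y)) has_derivative (\<lambda>v. (0, v))) (at y)"
      by (intro has_derivative_Pair has_derivative_const has_derivative_ident)
    then show ?thesis
      by (rule has_derivative_compose) (use that frechet_derivative_works in blast)
  qed
  have lists: "map (Pair 0) bs \<in> lists (Basis :: ('a \<times> 'b) set)" if "bs \<in> lists Basis" for bs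
    using that by (auto simp: Basis_prod_def)
  have eq: "partials bs (\<lambda>y. H (x, y)) = (\<lambda>y. partials (map (Pair 0) bs) H (x, y))"
    if "bs \<in> lists Basis" for bs
    using that
  proof (induction bs)
    case (Cons b bs)
    then have bs: "bs \<in> lists Basis" by simp
    show ?case
    proof
      fix y
      from frechet_derivative_at[OF der[OF schwartz_differentiable[OF H lists[OF bs]], of y]]
      show "partials (b # bs) (\<lambda>y. H (x, y)) y = partials (map (Pair 0) (b # bs)) H (x, y)"
        unfolding partials.simps Cons.IH list.map by metis
    qed
  qed simp
  show "partials bs (\<lambda>y. H (x, y)) = (\<lambda>y. partials (map (Pair 0) bs) H (x, y))"
    by (rule eq) fact
  show "partials bs (\<lambda>y. H (x, y)) differentiable (at y)"
    unfolding eq[OF assms(2)]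
    using der[OF schwartz_differentiable[OF H lists[OF assms(2)]]] by (auto simp: differentiable_def)
qed

lemma map_Pair_Basis:
  "bs \<in> lists (Basis :: 'b::euclidean_space set) \<Longrightarrow>
    map (Pair 0) bs \<in> lists (Basis :: ('a::euclidean_space \<times> 'b) set)"
  by (auto simp: Basis_prod_def)

lemma schwartz_slice:
  fixes H :: "'a::euclidean_space \<times> 'b::euclidean_space \<Rightarrow> complex"
  assumes H: "H \<in> schwartz"
  shows "(\<lambda>y. H (x, y)) \<in> schwartz"
proof -
  have "bounded (range (\<lambda>y. norm y ^ k *\<^sub>R partials bs (\<lambda>y. H (x, y)) y))"
    if bs: "bs \<in> lists Basis" for bs k
  proof -
    obtain C where C: "\<And>z. norm z ^ k * norm (partials (map (Pair 0) bs) H z) \<le> C"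
      using schwartz_bounds[OF H map_Pair_Basis[OF bs]] by blast
    have "norm y ^ k * norm (partials (map (Pair 0) bs) H (x, y)) \<le> C" for y
    proof -
      have "norm y \<le> norm (x, y)" using norm_snd_le[of y x] by simp
      then show ?thesis
        by (intro order_trans[OF mult_right_mono C[of "(x, y)"]] power_mono) auto
    qed
    then show ?thesis
      unfolding partials_slice(1)[OF H bs] by (auto simp: bounded_iff)
  qed
  then show ?thesis
    unfolding schwartz_def smooth_def using partials_slice(2)[OF H] by blast
qed

section \<open>Partial Fourier transforms\<close>

lemma borel_measurable_fst_snd [measurable]:
  "fst \<in> borel_measurable (borel :: ('a::second_countable_topology \<times> 'b::second_countable_topology) measure)"
  "snd \<in> borel_measurable (borel :: ('a \<times> 'b) measure)"
  unfolding borel_prod[symmetric] by measurable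

lemma lborel_isometry_affine:
  fixes t :: "'a::euclidean_space"
  assumes "\<bar>c\<bar> = 1"
  shows "distr lborel borel (\<lambda>x. t + c *\<^sub>R x) = lborel"
proof -
  have "c \<noteq> 0" using assms by auto
  from lborel_affine[OF this, of t] show ?thesis
    by (simp add: assms density_1)
qed

text \<open>Exchanging the coordinates, reflecting each of them and translating preserves Lebesgue measure.
  The rotation \<open>(x, \<omega>) \<mapsto> (- \<omega>, x)\<close> of the symplectic Fourier transform and the reflection and
  translation of a convolution are all of this kind.\<close>

lemma lborel_swap_affine:
  fixes s :: "'b::euclidean_space" and t :: "'a::euclidean_space"
  assumes "\<bar>c\<bar> = 1" and "\<bar>d\<bar> = 1"
  shows "distr lborel borel (\<lambda>p. (s + c *\<^sub>R snd p, t + d *\<^sub>R fst p)) = (lborel :: ('b \<times> 'a) measure)"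
proof -
  let ?f = "\<lambda>x. s + c *\<^sub>R x" and ?g = "\<lambda>y. t + d *\<^sub>R y"
  have "(lborel :: ('b \<times> 'a) measure) = distr lborel borel ?f \<Otimes>\<^sub>M distr lborel borel ?g"
    by (simp only: lborel_isometry_affine assms lborel_prod)
  also have "\<dots> = distr (lborel \<Otimes>\<^sub>M lborel) (borel \<Otimes>\<^sub>M borel) (\<lambda>(x, y). (?f x, ?g y))"
    by (rule pair_measure_distr) (auto simp: lborel_isometry_affine assms intro: sigma_finite_lborel)
  also have "lborel \<Otimes>\<^sub>M lborel = distr (lborel \<Otimes>\<^sub>M lborel) (lborel \<Otimes>\<^sub>M lborel) (\<lambda>(x::'a, y::'b). (y, x))"
    by (rule lborel_pair.distr_pair_swap)
  also have "distr (distr (lborel \<Otimes>\<^sub>M lborel) (lborel \<Otimes>\<^sub>M lborel) (\<lambda>(x::'a, y::'b). (y, x)))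
      (borel \<Otimes>\<^sub>M borel) (\<lambda>(x, y). (?f x, ?g y))
      = distr (lborel \<Otimes>\<^sub>M lborel) (borel \<Otimes>\<^sub>M borel) (\<lambda>p. (?f (snd p), ?g (fst p)))"
    by (subst distr_distr) (auto simp: comp_def case_prod_beta)
  finally show ?thesis by (simp add: lborel_prod borel_prod)
qed

lemma integral_swap_affine:
  fixes F :: "'b::euclidean_space \<times> 'a::euclidean_space \<Rightarrow> complex"
  assumes "\<bar>c\<bar> = 1" and "\<bar>d\<bar> = 1" and [measurable]: "F \<in> borel_measurable borel"
  shows "(LINT p|lborel. F (s + c *\<^sub>R snd p, t + d *\<^sub>R fst p)) = (LINT p|lborel. F p)"
    and "integrable lborel (\<lambda>p. F (s + c *\<^sub>R snd p, t + d *\<^sub>R fst p)) \<longleftrightarrow> integrable lborel F"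
proof -
  let ?T = "\<lambda>p. (s + c *\<^sub>R snd p, t + d *\<^sub>R fst p)"
  have T: "?T \<in> measurable lborel borel"
    by measurable
  show "(LINT p|lborel. F (s + c *\<^sub>R snd p, t + d *\<^sub>R fst p)) = (LINT p|lborel. F p)"
    using integral_distr[OF T assms(3)] by (simp only: lborel_swap_affine assms)
  show "integrable lborel (\<lambda>p. F (s + c *\<^sub>R snd p, t + d *\<^sub>R fst p)) \<longleftrightarrow> integrable lborel F"
    using integrable_distr_eq[OF T assms(3)] by (simp only: lborel_swap_affine assms)
qed

lemma lborel_integral_iterated:
  fixes F :: "'a::euclidean_space \<times> 'b::euclidean_space \<Rightarrow> complex"
  assumes "integrable lborel F"
  shows "(LINT p|lborel. F p) = (LINT x|lborel. LINT y|lborel. F (x, y))"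
  using lborel_pair.integral_fst'[of F] assms by (simp add: lborel_prod)

theorem schwartz_fourier_inversion:
  assumes \<phi>: "\<phi> \<in> schwartz"
  shows "(LINT w|lborel. phase (x \<bullet> w) * fourier \<phi> w) = \<phi> x"
proof -
  obtain B where B: "\<And>x. norm x ^ 0 * norm (partials [] \<phi> x) \<le> B"
    using schwartz_bounds[OF \<phi>] by blast
  show ?thesis
  proof (rule fourier_inversion)
    show "integrable lborel \<phi>" using schwartz_integrable[OF \<phi>, of "[]"] by simp
    show "integrable lborel (fourier \<phi>)" by (rule integrable_fourier_schwartz[OF \<phi>])
    show "continuous_on UNIV \<phi>" using schwartz_continuous[OF \<phi>, of "[]"] by simp
    show "norm (\<phi> x) \<le> B" for x using B[of x] by simp
  qed
qed

text \<open>The majorant \<open>C / decay_weight (x, y)\<close> of the derivatives of \<open>H\<close> splits as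
  \<open>(C / decay_weight x) / decay_weight y\<close>. The decay estimate for the slice at \<open>x\<close> therefore has the
  constant \<open>C / decay_weight x\<close>, and the product form is recovered for the partial transform.\<close>

theorem integrable_partial_fourier:
  fixes H :: "'a::euclidean_space \<times> 'b::euclidean_space \<Rightarrow> complex"
  assumes H: "H \<in> schwartz"
  shows "integrable lborel (\<lambda>p. fourier (\<lambda>y. H (fst p, y)) (snd p))"
proof -
  have "\<exists>C. \<forall>z. norm (partials (map (Pair 0) bs) H z) \<le> C / decay_weight z"
    if "bs \<in> decay_lists" for bs
    using that decay_lists map_Pair_Basis by (intro schwartz_decay[OF H]) blast
  from uniform_decay_bound[of decay_lists "\<lambda>bs. partials (map (Pair 0) bs) H", OF decay_lists(2) this] obtain C where
    C: "\<And>bs z. bs \<in> decay_lists \<Longrightarrow> norm (partials (map (Pair 0) bs) H z) \<le> C / decay_weight z"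
    by blast
  have [measurable]: "H \<in> borel_measurable borel"
    using schwartz_measurable[OF H, of "[]"] by simp
  show ?thesis
  proof (rule integrable_decay(1))
    show "(\<lambda>p. fourier (\<lambda>y. H (fst p, y)) (snd p)) \<in> borel_measurable borel"
      unfolding fourier_phase by measurable
    fix p :: "'a \<times> 'b"
    obtain x w where p: "p = (x, w)" by force
    have "norm (fourier (\<lambda>y. H (x, y)) w) \<le> decay_constant TYPE('b) * (C / decay_weight x) / decay_weight w"
    proof (rule fourier_decay[OF schwartz_slice[OF H]])
      fix bs :: "'b list" and y assume bs: "bs \<in> decay_lists"
      then have l: "bs \<in> lists Basis" using decay_lists by blast
      show "norm (partials bs (\<lambda>y. H (x, y)) y) \<le> C / decay_weight x / decay_weight y"
        unfolding partials_slice(1)[OF H l] using C[OF bs, of "(x, y)"] by (simp add: decay_weight_Pair)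
    qed
    then show "norm (fourier (\<lambda>y. H (fst p, y)) (snd p)) \<le> decay_constant TYPE('b) * C / decay_weight p"
      by (simp add: p decay_weight_Pair)
  qed
qed

section \<open>The kernel of the Cohen class\<close>

lemma cohen_chirp_phase: "cohen_chirp M (\<xi>, \<eta>) = phase (\<eta> \<bullet> (M *v \<xi>))"
  by (simp add: cohen_chirp_def phase_exp)

lemma continuous_on_matrix_vector_mult:
  "continuous_on S f \<Longrightarrow> continuous_on S (\<lambda>x. (M :: real^'n^'m) *v f x)"
  by (rule bounded_linear.continuous_on[OF matrix_vector_mul_bounded_linear])

lemma borel_measurable_cohen_chirp [measurable]: "cohen_chirp M \<in> borel_measurable borel"
proof -
  have "cohen_chirp M = (\<lambda>p. phase (snd p \<bullet> (M *v fst p)))"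
    by (auto simp: cohen_chirp_phase)
  moreover have "continuous_on UNIV (\<lambda>p. phase (snd p \<bullet> (M *v fst p)))"
    by (intro continuous_intros continuous_on_matrix_vector_mult)
  ultimately show ?thesis by (simp add: borel_measurable_continuous_onI)
qed

lemma norm_cohen_chirp: "norm (cohen_chirp M p) = 1"
  by (cases p) (simp add: cohen_chirp_phase)

text \<open>The rotation moves from the test function to its Fourier transform, because it is orthogonal.\<close>

lemma cohen_kernel_eq:
  fixes \<phi> :: "(real^'n) \<times> (real^'n) \<Rightarrow> complex"
  assumes [measurable]: "\<phi> \<in> borel_measurable borel"
  shows "cohen_kernel M \<phi> = (LINT p|lborel. cohen_chirp M p * fourier \<phi> (- snd p, fst p))"
proof -
  have "fourier (\<lambda>(x, \<omega>). \<phi> (- \<omega>, x)) p = fourier \<phi> (- snd p, fst p)" for p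
  proof -
    have m: "(\<lambda>w. phase (- ((- snd p, fst p) \<bullet> w)) * \<phi> w) \<in> borel_measurable borel"
      by measurable
    show ?thesis
      using integral_swap_affine(1)[OF _ _ m, of "-1" 1 0 0]
      by (simp add: fourier_phase case_prod_beta inner_prod_def algebra_simps)
  qed
  then show ?thesis
    by (simp add: cohen_kernel_def symplectic_fourier_dist_def fourier_dist_def regular_dist_def)
qed

lemma integrable_cohen_kernel:
  fixes \<phi> :: "(real^'n) \<times> (real^'n) \<Rightarrow> complex"
  assumes \<phi>: "\<phi> \<in> schwartz"
  shows "integrable lborel (\<lambda>p. cohen_chirp M p * fourier \<phi> (- snd p, fst p))"
proof -
  have [measurable]: "fourier \<phi> \<in> borel_measurable borel"
    using integrable_fourier_schwartz[OF \<phi>] by (simp add: borel_measurable_integrable)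
  have i: "integrable lborel (\<lambda>p. fourier \<phi> (0 + (-1) *\<^sub>R snd p, 0 + 1 *\<^sub>R fst p))"
    by (subst integral_swap_affine(2)) (simp_all add: integrable_fourier_schwartz[OF \<phi>])
  note [measurable] = borel_measurable_integrable[OF i, simplified]
  show ?thesis
    by (rule Bochner_Integration.integrable_bound[OF i]) (auto simp: norm_mult norm_cohen_chirp)
qed

text \<open>The chirp has absolute value \<open>1\<close>. So the kernel is bounded by the \<open>L\<^sup>1\<close> norm of the Fourier
  transform, which \<open>fourier_diff_decay\<close> controls by finitely many seminorms.\<close>

theorem cohen_kernel_tempered: "tempered (cohen_kernel (M :: real^'n^'n))"
proof -
  let ?V = "TYPE((real^'n) \<times> (real^'n))" and ?N = "DIM((real^'n) \<times> (real^'n))"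
  have meas: "\<phi> \<in> borel_measurable borel" if "\<phi> \<in> schwartz" for \<phi> :: "(real^'n) \<times> (real^'n) \<Rightarrow> complex"
    using schwartz_measurable[OF that, of "[]"] by simp
  have fint: "integrable lborel (\<lambda>w. phase (- (z \<bullet> w)) * \<phi> w)" if "\<phi> \<in> schwartz"
    for z and \<phi> :: "(real^'n) \<times> (real^'n) \<Rightarrow> complex"
    using schwartz_integrable[OF that, of "[]"] by (intro integrable_phase_mult) auto
  show ?thesis
    unfolding tempered_def
  proof (intro conjI ballI allI impI)
    fix \<phi> \<psi> :: "(real^'n) \<times> (real^'n) \<Rightarrow> complex"
    assume s: "\<phi> \<in> schwartz" "\<psi> \<in> schwartz"
    note [measurable] = meas[OF s(1)] meas[OF s(2)]
    have "fourier (\<lambda>x. \<phi> x + \<psi> x) z = fourier \<phi> z + fourier \<psi> z" for z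
      unfolding fourier_phase distrib_left by (rule Bochner_Integration.integral_add) (intro fint s)+
    then show "cohen_kernel M (\<lambda>x. \<phi> x + \<psi> x) = cohen_kernel M \<phi> + cohen_kernel M \<psi>"
      by (simp add: cohen_kernel_eq distrib_left integrable_cohen_kernel s)
  next
    fix c and \<phi> :: "(real^'n) \<times> (real^'n) \<Rightarrow> complex"
    assume s: "\<phi> \<in> schwartz"
    note [measurable] = meas[OF s]
    have "fourier (\<lambda>x. c * \<phi> x) z = c * fourier \<phi> z" for z
      unfolding fourier_phase mult.left_commute[of _ c] by simp
    then show "cohen_kernel M (\<lambda>x. c * \<phi> x) = c * cohen_kernel M \<phi>"
      by (simp add: cohen_kernel_eq mult.left_commute[of _ c])
  next
    fix \<phi> :: "nat \<Rightarrow> (real^'n) \<times> (real^'n) \<Rightarrow> complex" and \<psi>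
    assume s: "\<forall>n. \<phi> n \<in> schwartz" "\<psi> \<in> schwartz" and lim: "schwartz_tendsto \<phi> \<psi>"
    define I where "I = (LINT x|lborel. 1 / decay_weight (x :: (real^'n) \<times> (real^'n)))"
    define A where "A = decay_constant ?V * 2 ^ (?N + 1) * I"
    have est: "norm (cohen_kernel M (\<phi> n) - cohen_kernel M \<psi>) \<le> A * e"
      if e: "\<And>bs k x. bs \<in> decay_lists \<Longrightarrow> k \<in> {0, 2 * ?N} \<Longrightarrow>
        norm (norm x ^ k *\<^sub>R partials bs (\<phi> n) x - norm x ^ k *\<^sub>R partials bs \<psi> x) \<le> e" for n e
    proof -
      have "norm (partials bs (\<phi> n) x - partials bs \<psi> x) \<le> 2 ^ (?N + 1) * e / decay_weight x"
        if bs: "bs \<in> decay_lists" for bs x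
        using e[OF bs, of 0 x] e[OF bs, of "2 * ?N" x]
        by (intro decay_of_norm_bounds) (auto simp flip: scaleR_diff_right)
      then have d: "norm (fourier (\<phi> n) z - fourier \<psi> z) \<le> decay_constant ?V * (2 ^ (?N + 1) * e) / decay_weight z" for z
        using s by (intro fourier_diff_decay) auto
      have "cohen_kernel M (\<phi> n) - cohen_kernel M \<psi> = (LINT p|lborel. cohen_chirp M p * fourier (\<phi> n) (- snd p, fst p)
          - cohen_chirp M p * fourier \<psi> (- snd p, fst p))"
        using s by (simp add: cohen_kernel_eq meas integrable_cohen_kernel)
      also have "norm \<dots> \<le> decay_constant ?V * (2 ^ (?N + 1) * e) * I"
        unfolding I_def
      proof (rule integrable_decay(2))
        show "(\<lambda>p. cohen_chirp M p * fourier (\<phi> n) (- snd p, fst p)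
            - cohen_chirp M p * fourier \<psi> (- snd p, fst p)) \<in> borel_measurable borel"
          using s integrable_cohen_kernel borel_measurable_integrable
          by (intro borel_measurable_diff) force+
        fix p :: "(real^'n) \<times> (real^'n)"
        have w: "decay_weight (- snd p, fst p) = decay_weight p"
          by (cases p) (simp add: decay_weight_Pair)
        show "norm (cohen_chirp M p * fourier (\<phi> n) (- snd p, fst p)
            - cohen_chirp M p * fourier \<psi> (- snd p, fst p))
          \<le> decay_constant ?V * (2 ^ (?N + 1) * e) / decay_weight p"
          unfolding right_diff_distrib[symmetric] norm_mult norm_cohen_chirp mult_1
          using d[of "(- snd p, fst p)"] unfolding w .
      qed
      finally show ?thesis by (simp add: A_def mult_ac)
    qed
    show "(\<lambda>n. cohen_kernel M (\<phi> n)) \<longlonglongrightarrow> cohen_kernel M \<psi>"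
    proof (rule tendstoI)
      fix r :: real assume "0 < r"
      \<comment> \<open>Adding \<open>1\<close> avoids a division by zero.\<close>
      define e where "e = r / (\<bar>A\<bar> + 1)"
      have "0 < e" using \<open>0 < r\<close> by (simp add: e_def)
      have "\<forall>\<^sub>F n in sequentially. \<forall>bs\<in>decay_lists. \<forall>k\<in>{0, 2 * ?N}. \<forall>x.
          norm (norm x ^ k *\<^sub>R partials bs (\<phi> n) x - norm x ^ k *\<^sub>R partials bs \<psi> x) \<le> e"
      proof (intro eventually_ball_finite ballI decay_lists(2) finite.intros)
        fix bs k assume "bs \<in> (decay_lists :: ((real^'n) \<times> (real^'n)) list set)"
        then have "uniform_limit UNIV (\<lambda>n x. norm x ^ k *\<^sub>R partials bs (\<phi> n) x)
          (\<lambda>x. norm x ^ k *\<^sub>R partials bs \<psi> x) sequentially"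
          using lim decay_lists unfolding schwartz_tendsto_def by blast
        from uniform_limitD[OF this \<open>0 < e\<close>]
        show "\<forall>\<^sub>F n in sequentially. \<forall>x.
          norm (norm x ^ k *\<^sub>R partials bs (\<phi> n) x - norm x ^ k *\<^sub>R partials bs \<psi> x) \<le> e"
          by eventually_elim (auto simp: dist_norm less_imp_le)
      qed
      then show "\<forall>\<^sub>F n in sequentially. dist (cohen_kernel M (\<phi> n)) (cohen_kernel M \<psi>) < r"
      proof eventually_elim
        case (elim n)
        have "dist (cohen_kernel M (\<phi> n)) (cohen_kernel M \<psi>) \<le> A * e"
          unfolding dist_norm by (rule est) (use elim in blast)
        also have "\<dots> < (\<bar>A\<bar> + 1) * e" using \<open>0 < e\<close> by (intro mult_strict_right_mono) auto
        also have "\<dots> = r" by (simp add: e_def)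
        finally show ?case .
      qed
    qed
  qed
qed

text \<open>This is the identity behind the formula for the Wigner distribution. Both partial Fourier
  transforms of \<open>H\<close> occur, \<open>K\<close> in the second variable and \<open>K'\<close> in the first, and each is inverted
  once. Therefore \<open>H\<close> with exchanged arguments has to be a Schwartz function too.\<close>

theorem convolve_partial_fourier_cohen_kernel:
  fixes H :: "(real^'n) \<times> (real^'n) \<Rightarrow> complex"
  assumes H: "H \<in> schwartz" and H': "(\<lambda>p. H (snd p, fst p)) \<in> schwartz"
  shows "convolve (\<lambda>(x, \<omega>). fourier (\<lambda>y. H (x, y)) \<omega>) (cohen_kernel M) (x0, \<omega>0)
       = fourier (\<lambda>y. H (x0 + M *v y, y)) \<omega>0"
proof -
  define K where "K p = fourier (\<lambda>y. H (fst p, y)) (snd p)" for p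
  define K' where "K' p = fourier (\<lambda>x. H (x, fst p)) (snd p)" for p
  have K: "integrable lborel K"
    unfolding K_def[abs_def] by (rule integrable_partial_fourier[OF H])
  have K': "integrable lborel K'"
    using integrable_partial_fourier[OF H'] by (simp add: K'_def[abs_def])
  have [measurable]: "K \<in> borel_measurable borel" "K' \<in> borel_measurable borel"
    using K K' by (simp_all add: borel_measurable_integrable)
  have inv: "(LINT \<omega>|lborel. phase (\<xi> \<bullet> \<omega>) * K (x, \<omega>)) = H (x, \<xi>)" for x \<xi>
    using schwartz_fourier_inversion[OF schwartz_slice[OF H]] by (simp add: K_def)
  have inv': "(LINT \<eta>|lborel. phase (x \<bullet> \<eta>) * K' (\<xi>, \<eta>)) = H (x, \<xi>)" for x \<xi>
    using schwartz_fourier_inversion[OF schwartz_slice[OF H']] by (simp add: K'_def)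
  have inner: "fourier (\<lambda>(x, \<omega>). K ((x0, \<omega>0) - (- \<omega>, x))) (\<xi>, \<eta>)
      = phase (\<eta> \<bullet> x0) * phase (- (\<xi> \<bullet> \<omega>0)) * K' (\<xi>, \<eta>)" for \<xi> \<eta>
  proof -
    \<comment> \<open>The integrand in the new variables \<open>(x, \<omega>) = (x0 + b, \<omega>0 - a)\<close>, where \<open>(a, b)\<close> are the old ones.\<close>
    let ?G = "\<lambda>p. phase (- (\<xi> \<bullet> (\<omega>0 - snd p) + \<eta> \<bullet> (fst p - x0))) * K p"
    have "fourier (\<lambda>(x, \<omega>). K ((x0, \<omega>0) - (- \<omega>, x))) (\<xi>, \<eta>)
        = (LINT p|lborel. ?G (x0 + 1 *\<^sub>R snd p, \<omega>0 + (-1) *\<^sub>R fst p))"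
      by (simp add: fourier_phase case_prod_beta inner_prod_def)
    also have "\<dots> = (LINT p|lborel. ?G p)"
      by (rule integral_swap_affine(1)) auto
    also have "\<dots> = (LINT x|lborel. LINT \<omega>|lborel. ?G (x, \<omega>))"
      by (intro lborel_integral_iterated integrable_phase_mult K) measurable
    also have "\<dots> = (LINT x|lborel. phase (\<eta> \<bullet> x0) * phase (- (\<xi> \<bullet> \<omega>0)) * (phase (- (\<eta> \<bullet> x)) * H (x, \<xi>)))"
    proof (rule Bochner_Integration.integral_cong[OF refl])
      fix x
      have "phase (- (\<xi> \<bullet> (\<omega>0 - \<omega>) + \<eta> \<bullet> (x - x0)))
          = phase (\<eta> \<bullet> x0) * phase (- (\<xi> \<bullet> \<omega>0)) * phase (- (\<eta> \<bullet> x)) * phase (\<xi> \<bullet> \<omega>)" for \<omega>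
        by (simp add: phase_add[symmetric] inner_diff_right algebra_simps)
      then show "(LINT \<omega>|lborel. ?G (x, \<omega>))
          = phase (\<eta> \<bullet> x0) * phase (- (\<xi> \<bullet> \<omega>0)) * (phase (- (\<eta> \<bullet> x)) * H (x, \<xi>))"
        by (simp add: mult.assoc inv)
    qed
    finally show ?thesis by (simp add: K'_def fourier_phase)
  qed
  have "convolve K (cohen_kernel M) (x0, \<omega>0) = (LINT p|lborel. cohen_chirp M p *
      (phase (snd p \<bullet> x0) * phase (- (fst p \<bullet> \<omega>0)) * K' p))"
    unfolding convolve_def cohen_kernel_def symplectic_fourier_dist_def fourier_dist_def regular_dist_def
    by (rule Bochner_Integration.integral_cong[OF refl]) (metis inner prod.collapse)
  also have "\<dots> = (LINT p|lborel. phase (snd p \<bullet> (x0 + M *v fst p) - fst p \<bullet> \<omega>0) * K' p)"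
  proof (rule Bochner_Integration.integral_cong[OF refl])
    fix p :: "(real^'n) \<times> (real^'n)"
    have "phase (snd p \<bullet> (x0 + M *v fst p) - fst p \<bullet> \<omega>0)
        = cohen_chirp M p * (phase (snd p \<bullet> x0) * phase (- (fst p \<bullet> \<omega>0)))"
      by (cases p) (simp add: cohen_chirp_phase phase_add[symmetric] inner_add_right algebra_simps)
    then show "cohen_chirp M p * (phase (snd p \<bullet> x0) * phase (- (fst p \<bullet> \<omega>0)) * K' p)
        = phase (snd p \<bullet> (x0 + M *v fst p) - fst p \<bullet> \<omega>0) * K' p"
      by (simp add: mult.assoc)
  qed
  also have "\<dots> = (LINT \<xi>|lborel. LINT \<eta>|lborel. phase (\<eta> \<bullet> (x0 + M *v \<xi>) - \<xi> \<bullet> \<omega>0) * K' (\<xi>, \<eta>))"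
  proof -
    have "continuous_on UNIV (\<lambda>p::(real^'n) \<times> (real^'n). snd p \<bullet> (x0 + M *v fst p) - fst p \<bullet> \<omega>0)"
      by (intro continuous_intros continuous_on_matrix_vector_mult)
    then have "integrable lborel (\<lambda>p. phase (snd p \<bullet> (x0 + M *v fst p) - fst p \<bullet> \<omega>0) * K' p)"
      by (intro integrable_phase_mult[OF K']) (simp add: borel_measurable_continuous_onI)
    from lborel_integral_iterated[OF this] show ?thesis by simp
  qed
  also have "\<dots> = (LINT \<xi>|lborel. phase (- (\<omega>0 \<bullet> \<xi>)) * H (x0 + M *v \<xi>, \<xi>))"
  proof (rule Bochner_Integration.integral_cong[OF refl])
    fix \<xi> :: "real^'n"
    have "phase (\<eta> \<bullet> (x0 + M *v \<xi>) - \<xi> \<bullet> \<omega>0)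
        = phase (- (\<omega>0 \<bullet> \<xi>)) * phase ((x0 + M *v \<xi>) \<bullet> \<eta>)" for \<eta>
      by (simp add: phase_add[symmetric] inner_commute)
    then show "(LINT \<eta>|lborel. phase (\<eta> \<bullet> (x0 + M *v \<xi>) - \<xi> \<bullet> \<omega>0) * K' (\<xi>, \<eta>))
        = phase (- (\<omega>0 \<bullet> \<xi>)) * H (x0 + M *v \<xi>, \<xi>)"
      by (simp add: mult.assoc inv')
  qed
  finally show ?thesis
    by (simp add: fourier_phase K_def[abs_def] case_prod_beta')
qed

section \<open>Matrix Wigner distributions in the Cohen class\<close>

lemma wigner_eq_fourier:
  "wigner f g (x, \<omega>) = fourier (\<lambda>y. f (x + (1/2) *\<^sub>R y) * cnj (g (x - (1/2) *\<^sub>R y))) \<omega>"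
  unfolding wigner_def fourier_def by (simp add: inner_commute mult.assoc)

lemma matrix_wigner_eq_fourier:
  "matrix_wigner A f g (x, \<omega>) = fourier (\<lambda>y. f (block11 A *v x + block12 A *v y) *
     cnj (g (block21 A *v x + block22 A *v y))) \<omega>"
  unfolding matrix_wigner_def fourier_def by (simp add: mult.assoc)

lemma blocks_cohen_matrix:
  "block11 (cohen_matrix M) = mat 1" "block12 (cohen_matrix M) = M + (1/2) *\<^sub>R mat 1"
  "block21 (cohen_matrix M) = mat 1" "block22 (cohen_matrix M) = M - (1/2) *\<^sub>R mat 1"
  by (simp_all add: cohen_matrix_def block_matrix_def block11_def block12_def block21_def
      block22_def vec_eq_iff)

lemma eq_cohen_matrixI:
  assumes "block11 A = mat 1" "block12 A = M + (1/2) *\<^sub>R mat 1"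
    "block21 A = mat 1" "block22 A = M - (1/2) *\<^sub>R mat 1"
  shows "A = cohen_matrix M"
proof -
  have "A $ i $ j = cohen_matrix M $ i $ j" for i j
    using assms
    by (cases i; cases j)
      (simp_all add: cohen_matrix_def block_matrix_def block11_def block12_def block21_def
        block22_def vec_eq_iff)
  then show ?thesis by (simp add: vec_eq_iff)
qed

text \<open>The arguments \<open>x + M y \<plusminus> y/2\<close> that arise from evaluating \<open>H\<close> at \<open>(x + M y, y)\<close> are the two
  block rows of \<open>A\<^sub>M\<close> applied to \<open>(x, y)\<close>.\<close>

theorem matrix_wigner_cohen_matrix:
  fixes f g :: "real^'n \<Rightarrow> complex"
  assumes f: "f \<in> schwartz" and g: "g \<in> schwartz"
  shows "matrix_wigner (cohen_matrix M) f g = convolve (wigner f g) (cohen_kernel M)"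
proof
  fix z :: "(real^'n) \<times> (real^'n)"
  obtain x \<omega> where z: "z = (x, \<omega>)" by force
  define H where "H p = f (fst p + (1/2) *\<^sub>R snd p) * cnj (g (fst p - (1/2) *\<^sub>R snd p))"
    for p :: "(real^'n) \<times> (real^'n)"
  have zero: "x = 0 \<and> y = 0" if "x + (1/2) *\<^sub>R y = 0" "x - (1/2) *\<^sub>R y = 0" for x y :: "real^'n"
  proof -
    have "y = (x + (1/2) *\<^sub>R y) - (x - (1/2) *\<^sub>R y)" by (simp flip: scaleR_add_left)
    then show ?thesis using that by simp
  qed
  have H: "H \<in> schwartz"
    unfolding H_def[abs_def]
  proof (rule schwartz_tensor_linear[OF f g])
    fix p :: "(real^'n) \<times> (real^'n)"
    assume "fst p + (1/2) *\<^sub>R snd p = 0" "fst p - (1/2) *\<^sub>R snd p = 0"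
    from zero[OF this] show "p = 0" by (simp add: prod_eq_iff)
  qed (auto intro!: linearI simp: algebra_simps)
  have H': "(\<lambda>p. H (snd p, fst p)) \<in> schwartz"
    unfolding H_def[abs_def] fst_conv snd_conv
  proof (rule schwartz_tensor_linear[OF f g])
    fix p :: "(real^'n) \<times> (real^'n)"
    assume "snd p + (1/2) *\<^sub>R fst p = 0" "snd p - (1/2) *\<^sub>R fst p = 0"
    from zero[OF this] show "p = 0" by (simp add: prod_eq_iff)
  qed (auto intro!: linearI simp: algebra_simps)
  have "wigner f g = (\<lambda>(x, \<omega>). fourier (\<lambda>y. H (x, y)) \<omega>)"
    by (auto simp: wigner_eq_fourier H_def)
  then have "convolve (wigner f g) (cohen_kernel M) z = fourier (\<lambda>y. H (x + M *v y, y)) \<omega>"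
    using convolve_partial_fourier_cohen_kernel[OF H H'] by (simp add: z)
  also have "\<dots> = matrix_wigner (cohen_matrix M) f g z"
    by (simp add: z matrix_wigner_eq_fourier blocks_cohen_matrix H_def matrix_vector_mult_add_rdistrib
        matrix_vector_mult_diff_rdistrib scaleR_matrix_vector_assoc[symmetric] add.assoc add_diff_eq)
  finally show "matrix_wigner (cohen_matrix M) f g z = convolve (wigner f g) (cohen_kernel M) z" ..
qed

section \<open>Necessity of the matrix form\<close>

lemma wigner_translate:
  "wigner (\<lambda>t. f (t - a)) (\<lambda>t. g (t - a)) z = wigner f g (z - (a, 0))"
  by (cases z) (simp add: wigner_eq_fourier algebra_simps)

lemma wigner_modulate:
  "wigner (\<lambda>t. phase (b \<bullet> t) * f t) (\<lambda>t. phase (b \<bullet> t) * g t) z = wigner f g (z - (0, b))"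
proof -
  obtain x \<omega> where z: "z = (x, \<omega>)" by force
  have merge: "phase (- (\<omega> \<bullet> y)) * (phase (b \<bullet> (x + (1/2) *\<^sub>R y)) * phase (- (b \<bullet> (x - (1/2) *\<^sub>R y))))
      = phase (- ((\<omega> - b) \<bullet> y))" for y
  proof -
    have "- (\<omega> \<bullet> y) + (b \<bullet> (x + (1/2) *\<^sub>R y) + - (b \<bullet> (x - (1/2) *\<^sub>R y))) = - ((\<omega> - b) \<bullet> y)"
      by (simp add: inner_add_right inner_diff_right inner_diff_left)
    then show ?thesis by (metis phase_add)
  qed
  have eq: "phase (- (\<omega> \<bullet> y)) * (phase (b \<bullet> (x + (1/2) *\<^sub>R y)) * f (x + (1/2) *\<^sub>R y) *
      cnj (phase (b \<bullet> (x - (1/2) *\<^sub>R y)) * g (x - (1/2) *\<^sub>R y)))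
      = phase (- ((\<omega> - b) \<bullet> y)) * (f (x + (1/2) *\<^sub>R y) * cnj (g (x - (1/2) *\<^sub>R y)))" for y
    unfolding merge[symmetric] by (simp add: cnj_phase mult_ac)
  have "z - (0, b) = (x, \<omega> - b)" by (simp add: z)
  then show ?thesis
    by (simp only: z wigner_eq_fourier fourier_phase eq)
qed

text \<open>Convolution commutes with translations, so every covariance of the Wigner distribution under
  translations of phase space passes to the members of the Cohen class.\<close>

lemma cohen_class_covariant:
  assumes "cohen_class Q" and "f \<in> schwartz" "g \<in> schwartz" "f' \<in> schwartz" "g' \<in> schwartz"
    and "\<And>z. wigner f' g' z = wigner f g (z - c)"
  shows "Q f' g' z = Q f g (z - c)"
proof -
  obtain \<theta> where "\<And>f g. f \<in> schwartz \<Longrightarrow> g \<in> schwartz \<Longrightarrow> Q f g = convolve (wigner f g) \<theta>"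
    using assms(1) unfolding cohen_class_def by blast
  then show ?thesis
    using assms by (simp add: convolve_def diff_diff_eq add.commute)
qed

lemma gaussian_translate_schwartz:
  "(\<lambda>t::'a::euclidean_space. exp (- complex_of_real ((t - a) \<bullet> (t - a)))) \<in> schwartz"
proof -
  have "linear (\<lambda>t::'a. complex_of_real (2 * (a \<bullet> t)))"
    by (auto intro!: linearI simp: inner_add_right scaleR_conv_of_real[where 'a = complex] algebra_simps)
  from schwartz_gaussian[OF this, of "- complex_of_real (a \<bullet> a)"] show ?thesis
    by (rule back_subst[of "\<lambda>f. f \<in> schwartz"])
      (auto simp: inner_diff_left inner_diff_right inner_commute algebra_simps)
qed

lemma gaussian_modulate_schwartz:
  "(\<lambda>t::'a::euclidean_space. phase (b \<bullet> t) * exp (- complex_of_real (t \<bullet> t))) \<in> schwartz"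
proof -
  have "linear (\<lambda>t::'a. 2 * complex_of_real pi * \<i> * complex_of_real (b \<bullet> t))"
    by (auto intro!: linearI simp: inner_add_right scaleR_conv_of_real[where 'a = complex] algebra_simps)
  from schwartz_gaussian[OF this, of 0] show ?thesis
    by (rule back_subst[of "\<lambda>f. f \<in> schwartz"])
      (auto simp: phase_exp mult_exp_exp add.commute)
qed

text \<open>An inner product that is an integer for every \<open>b\<close> vanishes, since scaling \<open>b\<close> would make it \<open>1/2\<close>.\<close>

lemma eq_0_if_phase_inner_eq_1:
  fixes q :: "'a::real_inner"
  assumes "\<And>b. phase (b \<bullet> q) = 1"
  shows "q = 0"
proof (rule ccontr)
  assume "q \<noteq> 0"
  then have "((1 / (2 * (q \<bullet> q))) *\<^sub>R q) \<bullet> q = 1 / 2" by simp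
  then have "phase (1 / 2) = 1" using assms by metis
  then show False by (simp add: phase_def)
qed

lemma block_matrix_vector_eq_0:
  fixes A :: "real^('n::finite + 'n)^('n + 'n)"
  assumes "invertible A" and "block11 A *v x + block12 A *v y = 0" "block21 A *v x + block22 A *v y = 0"
  shows "x = 0 \<and> y = 0"
proof -
  define z :: "real^('n + 'n)" where "z = (\<chi> i. case i of Inl i \<Rightarrow> x $ i | Inr i \<Rightarrow> y $ i)"
  have z: "z $ Inl i = x $ i" "z $ Inr i = y $ i" for i by (simp_all add: z_def)
  have sum_Plus: "(\<Sum>j\<in>UNIV. h j) = (\<Sum>j\<in>UNIV. h (Inl j)) + (\<Sum>j\<in>UNIV. h (Inr j))" for h :: "'n + 'n \<Rightarrow> real"
    unfolding UNIV_Plus_UNIV[symmetric] by (subst sum.Plus) (auto simp: comp_def)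
  have "(A *v z) $ Inl i = (block11 A *v x + block12 A *v y) $ i" for i
    by (simp add: matrix_vector_mult_def sum_Plus z block11_def block12_def)
  moreover have "(A *v z) $ Inr i = (block21 A *v x + block22 A *v y) $ i" for i
    by (simp add: matrix_vector_mult_def sum_Plus z block21_def block22_def)
  ultimately have "(A *v z) $ i = 0" for i
    using assms(2,3) by (cases i) auto
  then have "A *v z = 0" by (simp add: vec_eq_iff)
  moreover obtain B where "B ** A = mat 1" using assms(1) unfolding invertible_def by blast
  ultimately have "z = 0"
    by (metis matrix_vector_mul_assoc matrix_vector_mul_lid matrix_vector_mult_0_right)
  then have "x $ i = 0" "y $ i = 0" for i using z[of i] by simp_all
  then show ?thesis by (simp add: vec_eq_iff)
qed

text \<open>Invertibility of \<open>A\<close> enters twice: it makes the tensor products below Schwartz functions, and it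
  makes the two block rows of \<open>A\<close> take every pair of values.\<close>

locale invertible_block_matrix =
  fixes A :: "real^('n::finite + 'n)^('n + 'n)"
  assumes invertible: "invertible A"
begin

definition rows1 :: "(real^'n) \<times> (real^'n) \<Rightarrow> real^'n" where
  "rows1 p = block11 A *v fst p + block12 A *v snd p"

definition rows2 :: "(real^'n) \<times> (real^'n) \<Rightarrow> real^'n" where
  "rows2 p = block21 A *v fst p + block22 A *v snd p"

lemma linear_rows: "linear rows1" "linear rows2"
  by (auto intro!: linearI simp: rows1_def rows2_def matrix_vector_right_distrib
      matrix_vector_mult_scaleR algebra_simps)

lemma rows_eq_0: "rows1 p = 0 \<Longrightarrow> rows2 p = 0 \<Longrightarrow> p = 0"
  using block_matrix_vector_eq_0[OF invertible, of "fst p" "snd p"]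
  by (simp add: rows1_def rows2_def prod_eq_iff)

lemma rows_surj: "\<exists>p. rows1 p = u \<and> rows2 p = v"
proof -
  have l: "linear (\<lambda>p. (rows1 p, rows2 p))"
    using bounded_linear_Pair[of rows1 rows2] linear_rows
    by (simp add: linear_conv_bounded_linear)
  then have "inj (\<lambda>p. (rows1 p, rows2 p))"
    unfolding linear_injective_0[OF l] using rows_eq_0 by (metis fst_conv snd_conv fst_zero snd_zero)
  with l have "surj (\<lambda>p. (rows1 p, rows2 p))"
    by (rule linear_inj_imp_surj)
  from surjD[OF this, of "(u, v)"] show ?thesis by auto
qed

lemma matrix_wigner_rows:
  "matrix_wigner A f g (x, \<omega>) = fourier (\<lambda>y. f (rows1 (x, y)) * cnj (g (rows2 (x, y)))) \<omega>"
  by (simp add: matrix_wigner_eq_fourier rows1_def rows2_def)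

text \<open>Fourier inversion in the frequency recovers the integrand of a matrix Wigner distribution, so that
  identities between such distributions become pointwise identities.\<close>

lemma matrix_wigner_inversion:
  assumes "f \<in> schwartz" and "g \<in> schwartz"
  shows "(LINT \<omega>|lborel. phase (y \<bullet> \<omega>) * matrix_wigner A f g (x, \<omega>))
    = f (rows1 (x, y)) * cnj (g (rows2 (x, y)))"
  unfolding matrix_wigner_rows
  using schwartz_fourier_inversion[OF schwartz_slice[OF schwartz_tensor_linear[OF assms linear_rows rows_eq_0]]]
  by simp

lemma borel_measurable_matrix_wigner:
  assumes "f \<in> schwartz" and "g \<in> schwartz"
  shows "(\<lambda>\<omega>. matrix_wigner A f g (x, \<omega>)) \<in> borel_measurable borel"
proof -
  have "(\<lambda>y. f (rows1 (x, y)) * cnj (g (rows2 (x, y)))) \<in> schwartz"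
    using schwartz_slice[OF schwartz_tensor_linear[OF assms linear_rows rows_eq_0]] by simp
  from integrable_fourier_schwartz[OF this] show ?thesis
    unfolding matrix_wigner_rows by (simp add: borel_measurable_integrable)
qed

text \<open>For the Gaussian, inversion turns covariance under translation by \<open>a\<close> into an equality of
  exponents, \<open>|u - a|\<^sup>2 + |v - a|\<^sup>2 = |u - A11 a|\<^sup>2 + |v - A21 a|\<^sup>2\<close>. It holds for all \<open>u\<close> and \<open>v\<close> as
  the block rows are onto, so the terms linear in \<open>u\<close> and in \<open>v\<close> agree.\<close>

lemma cohen_class_blocks_left:
  assumes Q: "cohen_class (matrix_wigner A)"
  shows "block11 A *v a = a" and "block21 A *v a = a"
proof -
  define \<gamma> where "\<gamma> = (\<lambda>t::real^'n. exp (- complex_of_real (t \<bullet> t)))"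
  have \<gamma>: "\<gamma> \<in> schwartz" "(\<lambda>t. \<gamma> (t - a)) \<in> schwartz"
    using gaussian_translate_schwartz[of 0] gaussian_translate_schwartz[of a] by (simp_all add: \<gamma>_def)
  define r s where "r = block11 A *v a" and "s = block21 A *v a"
  have "(u - a) \<bullet> (u - a) + (v - a) \<bullet> (v - a) = (u - r) \<bullet> (u - r) + (v - s) \<bullet> (v - s)" for u v
  proof -
    obtain x y where xy: "rows1 (x, y) = u" "rows2 (x, y) = v"
      using rows_surj[of u v] by force
    have shift: "rows1 (x - a, y) = u - r" "rows2 (x - a, y) = v - s"
      using xy by (auto simp: rows1_def rows2_def r_def s_def matrix_vector_mult_diff_distrib)
    have "\<gamma> (u - a) * cnj (\<gamma> (v - a)) = \<gamma> (u - r) * cnj (\<gamma> (v - s))"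
      using matrix_wigner_inversion[OF \<gamma>(2) \<gamma>(2), of y x] matrix_wigner_inversion[OF \<gamma>(1) \<gamma>(1), of y "x - a"]
        cohen_class_covariant[OF Q \<gamma>(1) \<gamma>(1) \<gamma>(2) \<gamma>(2) wigner_translate]
      by (simp add: xy shift)
    then have "exp (- ((u - a) \<bullet> (u - a)) + - ((v - a) \<bullet> (v - a))) =
        exp (- ((u - r) \<bullet> (u - r)) + - ((v - s) \<bullet> (v - s)))"
      unfolding \<gamma>_def exp_add
      by (simp only: exp_of_real complex_cnj_complex_of_real of_real_minus[symmetric]
          of_real_mult[symmetric] of_real_eq_iff)
    then show ?thesis by simp
  qed
  note eq = this
  have "(a - r) \<bullet> u = 0" for u
    using eq[of u 0] eq[of 0 0] by (simp add: inner_diff_left inner_diff_right inner_commute)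
  then have "a - r = 0" using inner_eq_zero_iff by blast
  then show "block11 A *v a = a" by (simp add: r_def)
  have "(a - s) \<bullet> v = 0" for v
    using eq[of 0 v] eq[of 0 0] by (simp add: inner_diff_left inner_diff_right inner_commute)
  then have "a - s = 0" using inner_eq_zero_iff by blast
  then show "block21 A *v a = a" by (simp add: s_def)
qed

text \<open>Modulating the Gaussian by \<open>b\<close> multiplies the tensor product at \<open>(0, y)\<close> by the character at
  \<open>b \<bullet> (A12 y - A22 y)\<close>. Shifting the distribution by \<open>b\<close> in frequency multiplies it by the character
  at \<open>b \<bullet> y\<close>. The Gaussian has no zeros, so the two characters agree for every \<open>b\<close>.\<close>

lemma cohen_class_blocks_right:
  assumes Q: "cohen_class (matrix_wigner A)"
  shows "block12 A *v y - block22 A *v y = y"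
proof -
  define \<gamma> where "\<gamma> = (\<lambda>t::real^'n. exp (- complex_of_real (t \<bullet> t)))"
  define u v where "u = rows1 (0, y)" and "v = rows2 (0, y)"
  have "phase (b \<bullet> (u - v - y)) = 1" for b
  proof -
    define \<gamma>b where "\<gamma>b = (\<lambda>t. phase (b \<bullet> t) * \<gamma> t)"
    have s: "\<gamma> \<in> schwartz" "\<gamma>b \<in> schwartz"
      using gaussian_modulate_schwartz[of 0] gaussian_modulate_schwartz[of b]
      by (simp_all add: \<gamma>_def \<gamma>b_def)
    have cov: "matrix_wigner A \<gamma>b \<gamma>b z = matrix_wigner A \<gamma> \<gamma> (z - (0, b))" for z
      unfolding \<gamma>b_def by (rule cohen_class_covariant[OF Q s(1) s(1)])
        (use s(2) in \<open>simp_all add: \<gamma>b_def wigner_modulate\<close>)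
    let ?F = "\<lambda>\<omega>. phase (y \<bullet> \<omega>) * matrix_wigner A \<gamma> \<gamma> (0, \<omega> - b)"
    note [measurable] = borel_measurable_matrix_wigner[OF s(1) s(1), of 0]
    have "phase (b \<bullet> u) * phase (- (b \<bullet> v)) * (\<gamma> u * cnj (\<gamma> v)) = \<gamma>b u * cnj (\<gamma>b v)"
      by (simp add: \<gamma>b_def cnj_phase)
    also have "\<dots> = (LINT \<omega>|lborel. ?F \<omega>)"
      using matrix_wigner_inversion[OF s(2) s(2), of y 0] by (simp add: u_def v_def cov)
    also have "\<dots> = (LINT \<omega>|lborel. ?F (b + 1 *\<^sub>R \<omega>))"
      using lborel_affine_substitution(2)[of 1 ?F b] by simp
    also have "\<dots> = (LINT \<omega>|lborel. phase (y \<bullet> b) * (phase (y \<bullet> \<omega>) * matrix_wigner A \<gamma> \<gamma> (0, \<omega>)))"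
      by (simp add: inner_add_right phase_add mult.assoc)
    also have "\<dots> = phase (y \<bullet> b) * (\<gamma> u * cnj (\<gamma> v))"
      using matrix_wigner_inversion[OF s(1) s(1), of y 0] by (simp add: u_def v_def)
    finally have "phase (b \<bullet> u) * phase (- (b \<bullet> v)) = phase (y \<bullet> b)"
      by (simp add: \<gamma>_def)
    then have "phase (b \<bullet> u) * phase (- (b \<bullet> v)) * phase (- (y \<bullet> b)) = 1"
      by (simp add: phase_add[symmetric])
    then show ?thesis
      by (simp add: phase_add[symmetric] inner_diff_right inner_commute)
  qed
  then have "u - v - y = 0" by (rule eq_0_if_phase_inner_eq_1)
  then show ?thesis by (simp add: u_def v_def rows1_def rows2_def)
qed

theorem cohen_class_imp_cohen_matrix:
  assumes Q: "cohen_class (matrix_wigner A)"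
  shows "A = cohen_matrix (block12 A - (1/2) *\<^sub>R mat 1)"
proof (rule eq_cohen_matrixI)
  show "block11 A = mat 1" "block21 A = mat 1"
    using cohen_class_blocks_left[OF Q] by (simp_all add: matrix_eq)
  have "(block12 A - block22 A) *v y = mat 1 *v y" for y
    using cohen_class_blocks_right[OF Q, of y] by (simp add: matrix_vector_mult_diff_rdistrib)
  then have "block12 A - block22 A = mat 1" by (simp add: matrix_eq)
  then show "block22 A = block12 A - (1/2) *\<^sub>R mat 1 - (1/2) *\<^sub>R mat 1"
    by (simp add: algebra_simps flip: scaleR_add_left)
  show "block12 A = block12 A - (1/2) *\<^sub>R mat 1 + (1/2) *\<^sub>R mat 1" by simp
qed

end

theorem theorem1p1:
  fixes A :: "real^('n::finite + 'n)^('n + 'n)"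
  assumes "invertible A"
  shows "(cohen_class (matrix_wigner A) \<longleftrightarrow> (\<exists>M :: real^'n^'n. A = cohen_matrix M)) \<and>
    (\<forall>M :: real^'n^'n. A = cohen_matrix M \<longrightarrow>
       tempered (cohen_kernel M) \<and>
       (\<forall>f\<in>schwartz. \<forall>g\<in>schwartz.
          matrix_wigner (cohen_matrix M) f g = convolve (wigner f g) (cohen_kernel M)))"
proof -
  interpret invertible_block_matrix A by unfold_locales fact
  have kernel: "tempered (cohen_kernel M) \<and> (\<forall>f\<in>schwartz. \<forall>g\<in>schwartz.
      matrix_wigner (cohen_matrix M) f g = convolve (wigner f g) (cohen_kernel M))" for M :: "real^'n^'n"
    using cohen_kernel_tempered matrix_wigner_cohen_matrix by blast
  then have "cohen_class (matrix_wigner (cohen_matrix M))" for M :: "real^'n^'n"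
    unfolding cohen_class_def by blast
  then show ?thesis
    using kernel cohen_class_imp_cohen_matrix by blast
qed

end
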